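(* Let $S$ be a connected analytic submanifold of $\mathbb{R}^{n-1}$ and let $P,Q\in\mathbb{R}[\mathbf{x};x_n]$ have positive degrees $p_n$ and $q_n$ in $x_n$ respectively. Assume that $P$ and $Q$ never nullify on $S$ and that $P$ is projectively delineable over $S$. If $\mathrm{Res}^{p_n,q_n}_{x_n}(P,Q)$ is not the zero polynomial and is order-invariant over $S$, then for each projective root function $\theta$ of $P$ over $S$, either $H^{q_n}(Q)(\mathbf{x},u_{\mathbf{x}},v_{\mathbf{x}})=0$ for all $\mathbf{x}\in S$, or $H^{q_n}(Q)(\mathbf{x},u_{\mathbf{x}},v_{\mathbf{x}})\neq0$ for all $\mathbf{x}\in S$, where $(u_{\mathbf{x}},v_{\mathbf{x}})$ is any representative of $\theta(\mathbf{x})$.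
   Context: Write $\mathbf{x}=(x_1,\dots,x_{n-1})$; $E_{\mathbf{x}_0}P$ is the polynomial in $x_n$ obtained by substituting $\mathbf{x}_0$ for $\mathbf{x}$. "$P$ never nullifies on $S$" means $E_{\mathbf{x}}P\ne0$ for all $\mathbf{x}\in S$. $\mathrm{Res}^{p,q}_{x_n}(P,Q)\in\mathbb{R}[\mathbf{x}]$ is the resultant with respect to $x_n$ computed for formal degrees $(p,q)$ (Sylvester determinant of size $p+q$), so $E_{\mathbf{x}}\mathrm{Res}^{p,q}_{x_n}(P,Q)=\mathrm{Res}^{p,q}(E_{\mathbf{x}}P,E_{\mathbf{x}}Q)$. For a polynomial $f$ and a point $v$, $\mathrm{ord}(f,v)$ is the least total order of a partial derivative of $f$ nonzero at $v$; order-invariant on $S$ means constant order on $S$. $\mathbb{RP}^1$ is the quotient of $\mathbb{R}^2\setminus\{(0,0)\}$ by proportionality with the quotient topology; $(u:v)$ is the class of $(u,v)$. For $P=\sum_kc_k(\mathbf{x})x_n^k$ and $d\ge\deg_{x_n}P$, $H^{d}(P)(\mathbf{x},x_n,y)=\sum_kc_k(\mathbf{x})x_n^ky^{d-k}$. A projective root of a binary form $g(u,v)$ is $(u_0:v_0)$ with $g(u_0,v_0)=0$, with multiplicity (for $g\ne0$) the largest $m$ with $(v_0u-u_0v)^m\mid g$. $Z_{\mathbb{RP}^1}(P,S)=\{(\mathbf{x},(x_n:y))\in S\times\mathbb{RP}^1: H^{p_n}(P)(\mathbf{x},x_n,y)=0\}$. $P$ is projectively delineable on $S$ if there are $k\in\mathbb{N}$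 and continuous $\theta_1,\dots,\theta_k:S\to\mathbb{RP}^1$ (the projective root functions) such that $Z_{\mathbb{RP}^1}(P,S)$ is the disjoint union of their graphs and, for each $l$, there is $m_l\ge1$ with $\theta_l(\mathbf{x})$ a projective root of $E_{\mathbf{x}}H^{p_n}(P)$ of multiplicity $m_l$ for all $\mathbf{x}\in S$. *)

theory Defs
  imports "Subresultants.Resultant_Prelim" "HOL-Analysis.Analysis" "HOL-Library.Poly_Mapping"
begin

text \<open>The variables x_1..x_{n-1} are indexed by the finite type 'm (so n-1 = CARD('m)).
  A polynomial in R[x] is a finitely supported map from monomials (exponent vectors
  'm =>0 nat) to real coefficients; with Poly_Mapping's convolution product this is
  the polynomial ring R[x].  Polynomials in R[x; x_n] are univariate polynomials in
  x_n with coefficients in R[x], i.e. of type 'm mpoly poly.\<close>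

type_synonym 'm mpoly = "('m \<Rightarrow>\<^sub>0 nat) \<Rightarrow>\<^sub>0 real"

definition mpeval :: "'m::finite mpoly \<Rightarrow> real^'m \<Rightarrow> real" where
  "mpeval p x = (\<Sum>\<alpha>\<in>Poly_Mapping.keys p. Poly_Mapping.lookup p \<alpha> * (\<Prod>i\<in>UNIV. vec_nth x i ^ Poly_Mapping.lookup (\<alpha>::'m \<Rightarrow>\<^sub>0 nat) i))"

definition Eval :: "real^'m \<Rightarrow> 'm::finite mpoly poly \<Rightarrow> real poly" where
  "Eval x P = map_poly (\<lambda>c. mpeval c x) P"

definition mpdiff :: "('m \<Rightarrow>\<^sub>0 nat) \<Rightarrow> 'm::finite mpoly \<Rightarrow> 'm mpoly" where
  "mpdiff \<beta> p = Abs_poly_mapping (\<lambda>\<alpha>. Poly_Mapping.lookup p (\<alpha> + \<beta>) *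
      (\<Prod>i\<in>UNIV. real (fact (Poly_Mapping.lookup (\<alpha> + \<beta>) i)) / real (fact (Poly_Mapping.lookup \<alpha> i))))"

definition mp_ord :: "'m::finite mpoly \<Rightarrow> real^'m \<Rightarrow> nat" where
  "mp_ord f v = (LEAST k. \<exists>\<beta>. (\<Sum>i\<in>UNIV. Poly_Mapping.lookup \<beta> i) = k \<and> mpeval (mpdiff \<beta> f) v \<noteq> 0)"

definition order_invariant :: "'m::finite mpoly \<Rightarrow> (real^'m) set \<Rightarrow> bool" where
  "order_invariant f S \<longleftrightarrow> (\<exists>k. \<forall>v\<in>S. mp_ord f v = k)"

definition real_analytic_on :: "(real^'m::finite \<Rightarrow> real) \<Rightarrow> (real^'m) set \<Rightarrow> bool" where
  "real_analytic_on f U \<longleftrightarrow>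
     (\<forall>a\<in>U. \<exists>r>0. \<exists>c :: ('m \<Rightarrow>\<^sub>0 nat) \<Rightarrow> real. \<forall>x\<in>ball a r.
        ((\<lambda>\<alpha>. c \<alpha> * (\<Prod>i\<in>UNIV. (vec_nth x i - vec_nth a i) ^ Poly_Mapping.lookup \<alpha> i)) has_sum f x) UNIV)"

definition analytic_map_on :: "(real^'m::finite \<Rightarrow> real^'m) \<Rightarrow> (real^'m) set \<Rightarrow> bool" where
  "analytic_map_on \<phi> U \<longleftrightarrow> (\<forall>j. real_analytic_on (\<lambda>x. vec_nth (\<phi> x) j) U)"

definition analytic_submanifold :: "(real^'m::finite) set \<Rightarrow> bool" where
  "analytic_submanifold S \<longleftrightarrow>
     (\<forall>a\<in>S. \<exists>U V \<phi> \<psi> (D::'m set). open U \<and> a \<in> U \<and> open V \<and>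
        \<phi> ` U = V \<and> \<psi> ` V = U \<and> (\<forall>x\<in>U. \<psi> (\<phi> x) = x) \<and> (\<forall>y\<in>V. \<phi> (\<psi> y) = y) \<and>
        analytic_map_on \<phi> U \<and> analytic_map_on \<psi> V \<and>
        \<phi> ` (S \<inter> U) = V \<inter> {y. \<forall>i. i \<notin> D \<longrightarrow> vec_nth y i = 0})"

definition proj_class :: "real \<times> real \<Rightarrow> (real \<times> real) set" where
  "proj_class z = {(t * fst z, t * snd z) | t. t \<noteq> 0}"

definition RP1 :: "(real \<times> real) set set" where
  "RP1 = {proj_class z | z. z \<noteq> (0, 0)}"

definition RP1_top :: "(real \<times> real) set topology" where
  "RP1_top = topology (\<lambda>U. U \<subseteq> RP1 \<and>
      openin (top_of_set (- {(0, 0)})) {z \<in> - {(0, 0)}. proj_class z \<in> U})"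

text \<open>Binary forms g(u,v) are elements of R[v][u] = real poly poly (outer variable u).\<close>
definition bf_eval :: "real poly poly \<Rightarrow> real \<Rightarrow> real \<Rightarrow> real" where
  "bf_eval g u v = poly (poly g [:u:]) v"

definition hform :: "nat \<Rightarrow> real poly \<Rightarrow> real poly poly" where
  "hform d f = (\<Sum>k\<le>d. monom (monom (coeff f k) (d - k)) k)"

definition lin_form :: "real \<Rightarrow> real \<Rightarrow> real poly poly" where
  "lin_form u0 v0 = [: [:0, - u0:], [:v0:] :]"

definition bf_mult :: "real poly poly \<Rightarrow> real \<Rightarrow> real \<Rightarrow> nat" where
  "bf_mult g u0 v0 = (GREATEST m. lin_form u0 v0 ^ m dvd g)"

definition proj_root_mult :: "real poly poly \<Rightarrow> (real \<times> real) set \<Rightarrow> nat \<Rightarrow> bool" where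
  "proj_root_mult g c m \<longleftrightarrow> g \<noteq> 0 \<and>
     (\<exists>u0 v0. (u0, v0) \<noteq> (0, 0) \<and> c = proj_class (u0, v0) \<and>
        bf_eval g u0 v0 = 0 \<and> bf_mult g u0 v0 = m)"

definition Z_RP1 :: "'m::finite mpoly poly \<Rightarrow> (real^'m) set \<Rightarrow> ((real^'m) \<times> (real \<times> real) set) set" where
  "Z_RP1 P S = {(x, c). x \<in> S \<and> c \<in> RP1 \<and>
      (\<exists>(u, v)\<in>c. bf_eval (hform (degree P) (Eval x P)) u v = 0)}"

definition proj_delineable_with ::
  "(real^'m::finite) set \<Rightarrow> 'm mpoly poly \<Rightarrow> nat \<Rightarrow> (nat \<Rightarrow> real^'m \<Rightarrow> (real \<times> real) set) \<Rightarrow> bool" where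
  "proj_delineable_with S P k \<theta> \<longleftrightarrow>
     (\<forall>l<k. continuous_map (top_of_set S) RP1_top (\<theta> l)) \<and>
     Z_RP1 P S = (\<Union>l<k. {(x, \<theta> l x) | x. x \<in> S}) \<and>
     (\<forall>l<k. \<forall>l'<k. l \<noteq> l' \<longrightarrow> (\<forall>x\<in>S. \<theta> l x \<noteq> \<theta> l' x)) \<and>
     (\<forall>l<k. \<exists>m\<ge>1. \<forall>x\<in>S. proj_root_mult (hform (degree P) (Eval x P)) (\<theta> l x) m)"

definition proj_delineable :: "(real^'m::finite) set \<Rightarrow> 'm mpoly poly \<Rightarrow> bool" where
  "proj_delineable S P \<longleftrightarrow> (\<exists>k \<theta>. proj_delineable_with S P k \<theta>)"

end

theory Submission
  imports Defs "HOL-Complex_Analysis.Complex_Analysis" "HOL-Computational_Algebra.Fundamental_Theorem_Algebra"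
begin

text \<open>
  It suffices that the set of \<open>x \<in> S\<close> at which \<open>Q\<close> vanishes on \<open>\<theta>(x)\<close> is open in \<open>S\<close>; its complement
  is open by continuity. Near \<open>x\<^sub>0\<close> work in an affine chart of the projective line, with \<open>\<zeta>(x)\<close> the
  coordinate of \<open>\<theta>(x)\<close>, and restrict \<open>P\<close>, \<open>Q\<close> and the resultant \<open>F\<close> to the complex lines \<open>x + t w\<close>.
  For a suitable direction \<open>w\<close>, order-invariance gives \<open>F(x + t w) = t\<^sup>K h(x, t)\<close> with \<open>h(x\<^sub>0, 0) \<noteq> 0\<close>,
  so for \<open>x \<in> S\<close> near \<open>x\<^sub>0\<close> there is no common root when \<open>0 < |t| < R\<close>. As the multiplicity of \<open>\<zeta>(x)\<close> is
  constant, \<open>\<zeta>(x)\<close> is the only root of \<open>P\<close> at \<open>t = 0\<close> in a fixed disc. If \<open>Q(\<zeta>(x)) \<noteq> 0\<close>, the sum of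
  \<open>1 / Q\<close> over the roots of \<open>P\<close> in that disc extends to a holomorphic function of \<open>t\<close>, by the Bezout
  identity \<open>U P + V Q = F\<close> and Cauchy's formula. Its value \<open>m / Q(\<zeta>(x))\<close> at \<open>t = 0\<close> is bounded by its
  maximum on a circle \<open>|t| = r\<close>, uniformly in \<open>x\<close>. Hence \<open>Q(\<zeta>(x))\<close> is either zero or bounded away from
  zero, and by continuity it is zero near a zero.
\<close>

section \<open>Roots of a polynomial in a disc\<close>

definition disc_roots :: "complex \<Rightarrow> real \<Rightarrow> complex poly \<Rightarrow> complex multiset" where
  "disc_roots c r p = filter_mset (\<lambda>w. dist c w < r) (proots p)"

text \<open>For \<open>x\<close> inside the circle this is Cauchy's formula. For \<open>x\<close>
  outside, the integrand is holomorphic on the ball about \<open>c\<close> that reaches up to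
  \<open>x\<close>, and this ball contains the circle.\<close>

lemma has_contour_integral_linear_factor:
  assumes "0 < r" "dist c x \<noteq> r" "g holomorphic_on UNIV"
  shows "((\<lambda>z. g z / (z - x)) has_contour_integral (if dist c x < r then 2 * complex_of_real pi * \<i> * g x else 0))
           (circlepath c r)"
proof (cases "dist c x < r")
  case True
  have "((\<lambda>z. g z / (z - x)) has_contour_integral 2 * complex_of_real pi * \<i> * g x) (circlepath c r)"
    using True by (intro Cauchy_integral_circlepath_simple holomorphic_on_subset[OF assms(3)])
      (auto simp: dist_norm norm_minus_commute)
  with True show ?thesis by simp
next
  case False
  have "((\<lambda>z. g z / (z - x)) has_contour_integral 0) (circlepath c r)"
  proof (rule Cauchy_theorem_disc_simple)
    show "(\<lambda>z. g z / (z - x)) holomorphic_on ball c (dist c x)"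
      by (intro holomorphic_intros holomorphic_on_subset[OF assms(3)]) auto
    show "path_image (circlepath c r) \<subseteq> ball c (dist c x)"
      using assms False by auto
  qed auto
  with False show ?thesis by simp
qed

text \<open>The logarithmic derivative turns the product into a sum, so each linear factor
  contributes separately and multiplicities are counted by the multiset.\<close>

lemma has_contour_integral_prod_linear_factors:
  fixes M :: "complex multiset"
  assumes "0 < r" "\<And>x. x \<in># M \<Longrightarrow> dist c x \<noteq> r" "g holomorphic_on UNIV"
  defines "p \<equiv> \<Prod>x\<in>#M. [:-x, 1:]"
  shows "((\<lambda>z. g z * poly (pderiv p) z / poly p z) has_contour_integral
           2 * complex_of_real pi * \<i> * (\<Sum>w\<in>#filter_mset (\<lambda>w. dist c w < r) M. g w)) (circlepath c r)"
  using assms(2) unfolding p_def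
proof (induction M)
  case empty
  then show ?case by (simp add: has_contour_integral_0)
next
  case (add x M)
  define q where "q = (\<Prod>x\<in>#M. [:-x, 1:])"
  have 1: "((\<lambda>z. g z * poly (pderiv q) z / poly q z) has_contour_integral
           2 * complex_of_real pi * \<i> * (\<Sum>w\<in>#filter_mset (\<lambda>w. dist c w < r) M. g w)) (circlepath c r)"
    unfolding q_def using add by simp
  have 2: "((\<lambda>z. g z / (z - x)) has_contour_integral
             (if dist c x < r then 2 * complex_of_real pi * \<i> * g x else 0)) (circlepath c r)"
    using add.prems assms by (intro has_contour_integral_linear_factor) auto
  have q0: "poly q z \<noteq> 0" "z \<noteq> x" if "dist c z = r" for z
    using that add.prems[of z] by (auto simp: q_def poly_prod_mset)
  have "((\<lambda>z. g z * poly (pderiv (\<Prod>x\<in>#add_mset x M. [:-x, 1:])) z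
            / poly (\<Prod>x\<in>#add_mset x M. [:-x, 1:]) z) has_contour_integral
          (if dist c x < r then 2 * complex_of_real pi * \<i> * g x else 0) +
           2 * complex_of_real pi * \<i> * (\<Sum>w\<in>#filter_mset (\<lambda>w. dist c w < r) M. g w)) (circlepath c r)"
  proof (rule has_contour_integral_eq[OF has_contour_integral_add[OF 2 1]])
    fix z assume "z \<in> path_image (circlepath c r)"
    then have "dist c z = r" using assms by (auto simp: dist_commute)
    from q0[OF this] show "g z / (z - x) + g z * poly (pderiv q) z / poly q z =
        g z * poly (pderiv (\<Prod>x\<in>#add_mset x M. [:-x, 1:])) z / poly (\<Prod>x\<in>#add_mset x M. [:-x, 1:]) z"
      by (simp add: q_def[symmetric] pderiv_mult pderiv_pCons divide_simps del: mult_pCons_left)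
        (simp add: algebra_simps)
  qed
  then show ?case by (simp add: algebra_simps split: if_splits)
qed

text \<open>A weighted argument principle. It serves twice: with \<open>g = 1\<close> it counts
  roots, and with a cofactor divided by the resultant it shows that a sum over roots is holomorphic
  in the parameter.\<close>

lemma contour_integral_disc_roots:
  fixes p :: "complex poly"
  assumes "0 < r" "\<And>z. dist c z = r \<Longrightarrow> poly p z \<noteq> 0" "g holomorphic_on UNIV"
  shows "contour_integral (circlepath c r) (\<lambda>z. g z * poly (pderiv p) z / poly p z) =
           2 * complex_of_real pi * \<i> * (\<Sum>w\<in>#disc_roots c r p. g w)"
proof -
  have "dist c (c + r) = r" using assms(1) by (simp add: dist_norm)
  then have p0: "p \<noteq> 0" using assms(2) by force
  define q where "q = (\<Prod>x\<in>#proots p. [:-x, 1:])"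
  define a where "a = lead_coeff p"
  have p: "p = smult a q" and "a \<noteq> 0"
    using p0 unfolding q_def a_def by (simp_all add: complex_poly_decompose_multiset)
  have "((\<lambda>z. g z * poly (pderiv q) z / poly q z) has_contour_integral
           2 * complex_of_real pi * \<i> * (\<Sum>w\<in>#disc_roots c r p. g w)) (circlepath c r)"
    unfolding q_def disc_roots_def using assms p0
    by (intro has_contour_integral_prod_linear_factors) auto
  moreover have "g z * poly (pderiv q) z / poly q z = g z * poly (pderiv p) z / poly p z" for z
    using \<open>a \<noteq> 0\<close> unfolding p by (simp add: pderiv_smult)
  ultimately show ?thesis using contour_integral_unique by simp
qed

lemma continuous_on_contour_integral_circlepath:
  assumes "0 \<le> r" "continuous_on (U \<times> sphere c r) (\<lambda>(y, z). G y z)"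
  shows "continuous_on U (\<lambda>y. contour_integral (circlepath c r) (G y))"
proof -
  have "continuous_on U (\<lambda>y. integral (cbox 0 (1::real))
      (\<lambda>s. G y (circlepath c r s) * vector_derivative (circlepath c r) (at s)))"
  proof (rule integral_continuous_on_param)
    have c: "continuous_on UNIV (circlepath c r)"
      unfolding circlepath by (intro continuous_intros)
    have "circlepath c r s \<in> sphere c r" for s
      using assms(1) by (simp add: circlepath dist_norm norm_mult mult.assoc)
    then have "continuous_on (U \<times> cbox 0 1) (\<lambda>z. (\<lambda>(y, z). G y z) (fst z, circlepath c r (snd z)))"
      by (intro continuous_on_compose2[OF assms(2)] continuous_intros continuous_on_compose2[OF c])
        auto
    then show "continuous_on (U \<times> cbox 0 1)
        (\<lambda>(y, s). G y (circlepath c r s) * vector_derivative (circlepath c r) (at s))"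
      unfolding vector_derivative_circlepath split_beta by (intro continuous_intros) auto
  qed
  then show ?thesis by (simp add: contour_integral_integral)
qed

section \<open>Continuous families of polynomials\<close>

text \<open>The uniform bound \<open>d\<close> makes evaluation a sum of fixed length, hence jointly
  continuous, while the actual degree may drop within the family.\<close>

definition poly_family :: "nat \<Rightarrow> ('a::topological_space \<Rightarrow> complex poly) \<Rightarrow> bool" where
  "poly_family d A \<longleftrightarrow> (\<forall>y. degree (A y) \<le> d) \<and> (\<forall>k. continuous_on UNIV (\<lambda>y. coeff (A y) k))"

lemma poly_eq_sum_le:
  assumes "degree p \<le> d"
  shows "poly p (z::'a::comm_semiring_1) = (\<Sum>k\<le>d. coeff p k * z ^ k)"
  unfolding poly_altdef
  by (intro sum.mono_neutral_left) (use assms in \<open>auto simp: coeff_eq_0 not_le\<close>)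

lemma continuous_on_poly_family:
  assumes "poly_family d A"
  shows "continuous_on T (\<lambda>(y, z). poly (A y) z)"
proof -
  have "continuous_on T (\<lambda>yz. coeff (A (fst yz)) k)" for k
    using assms by (intro continuous_on_compose2[of UNIV "\<lambda>y. coeff (A y) k" T fst] continuous_intros)
      (auto simp: poly_family_def)
  moreover have "(\<lambda>(y, z). poly (A y) z) = (\<lambda>yz. \<Sum>k\<le>d. coeff (A (fst yz)) k * snd yz ^ k)"
    using assms by (auto simp: poly_family_def fun_eq_iff intro!: poly_eq_sum_le)
  ultimately show ?thesis by (auto intro!: continuous_intros)
qed

lemma poly_family_pderiv:
  assumes "poly_family d A"
  shows "poly_family d (\<lambda>y. pderiv (A y))"
  using assms unfolding poly_family_def
  by (auto simp: coeff_pderiv degree_pderiv intro!: continuous_intros le_diff_conv[THEN iffD2] le_SucI)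

text \<open>Up to the factor 2 pi i the root count is a contour integral, so it is continuous in the
  parameter. The degree bound leaves finitely many values, and a continuous function with finite
  range is constant on a connected set.\<close>

lemma size_disc_roots_constant:
  fixes A :: "'a::topological_space \<Rightarrow> complex poly"
  assumes "poly_family d A" "connected U" "0 < r"
    and nz: "\<And>y z. y \<in> U \<Longrightarrow> dist c z = r \<Longrightarrow> poly (A y) z \<noteq> 0"
    and "y \<in> U" "y' \<in> U"
  shows "size (disc_roots c r (A y)) = size (disc_roots c r (A y'))"
proof -
  define N where "N = (\<lambda>y. contour_integral (circlepath c r) (\<lambda>z. 1 * poly (pderiv (A y)) z / poly (A y) z))"
  have N: "N y = 2 * complex_of_real pi * \<i> * of_nat (size (disc_roots c r (A y)))" if "y \<in> U" for y
    unfolding N_def using nz[OF that] assms by (subst contour_integral_disc_roots) auto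
  have "continuous_on U N"
    unfolding N_def
  proof (rule continuous_on_contour_integral_circlepath)
    have "continuous_on (U \<times> sphere c r) (\<lambda>yz. (\<lambda>(y, z). poly (pderiv (A y)) z) yz / (\<lambda>(y, z). poly (A y) z) yz)"
      using nz by (intro continuous_on_divide continuous_on_poly_family[OF assms(1)]
          continuous_on_poly_family[OF poly_family_pderiv[OF assms(1)]]) auto
    then show "continuous_on (U \<times> sphere c r) (\<lambda>(y, z). 1 * poly (pderiv (A y)) z / poly (A y) z)"
      by (simp add: split_beta)
  qed (use assms in auto)
  moreover have "finite (N ` U)"
  proof (rule finite_subset)
    have "size (disc_roots c r (A y)) \<le> d" for y
      using size_filter_mset_lesseq[of _ "proots (A y)"] size_proots_le[of "A y"] assms(1)
      unfolding disc_roots_def poly_family_def by (meson order_trans)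
    then show "N ` U \<subseteq> (\<lambda>n. 2 * complex_of_real pi * \<i> * of_nat n) ` {..d}"
      using N by auto
  qed auto
  ultimately have "N y = N y'"
    using continuous_finite_range_constant[OF assms(2)] assms(5,6) unfolding constant_on_def by metis
  then show ?thesis using N assms(5,6) by simp
qed

section \<open>Functions holomorphic in a complex parameter\<close>

text \<open>Continuity of the derivative jointly in both arguments is needed for differentiation under
  the integral sign.\<close>

definition hol_param :: "('a::topological_space \<times> complex \<Rightarrow> complex) \<Rightarrow> bool" where
  "hol_param g \<longleftrightarrow> continuous_on UNIV g \<and> (\<exists>g'. continuous_on UNIV g' \<and>
     (\<forall>x t. ((\<lambda>t. g (x, t)) has_field_derivative g' (x, t)) (at t)))"

lemma hol_param_const: "hol_param (\<lambda>y. c)"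
  unfolding hol_param_def by (auto intro!: exI[of _ "\<lambda>_. 0"])

lemma hol_param_fst: "continuous_on UNIV f \<Longrightarrow> hol_param (\<lambda>y. f (fst y))"
  unfolding hol_param_def by (auto intro!: exI[of _ "\<lambda>_. 0"] continuous_intros continuous_on_compose2[of UNIV f])

lemma hol_param_snd: "hol_param snd"
  unfolding hol_param_def by (auto intro!: exI[of _ "\<lambda>_. 1"] continuous_intros)

lemma hol_param_add:
  assumes "hol_param f" "hol_param g" shows "hol_param (\<lambda>y. f y + g y)"
proof -
  from assms obtain f' g' where fg: "continuous_on UNIV f" "continuous_on UNIV f'"
      "continuous_on UNIV g" "continuous_on UNIV g'"
      "\<And>x t. ((\<lambda>t. f (x, t)) has_field_derivative f' (x, t)) (at t)"
      "\<And>x t. ((\<lambda>t. g (x, t)) has_field_derivative g' (x, t)) (at t)"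
    unfolding hol_param_def by metis
  show ?thesis
    unfolding hol_param_def
  proof (intro conjI exI allI)
    fix x t show "((\<lambda>t. f (x, t) + g (x, t)) has_field_derivative (\<lambda>y. f' y + g' y) (x, t)) (at t)"
      by (intro DERIV_add fg)
  qed (intro continuous_intros fg)+
qed

lemma hol_param_mult:
  assumes "hol_param f" "hol_param g" shows "hol_param (\<lambda>y. f y * g y)"
proof -
  from assms obtain f' g' where fg: "continuous_on UNIV f" "continuous_on UNIV f'"
      "continuous_on UNIV g" "continuous_on UNIV g'"
      "\<And>x t. ((\<lambda>t. f (x, t)) has_field_derivative f' (x, t)) (at t)"
      "\<And>x t. ((\<lambda>t. g (x, t)) has_field_derivative g' (x, t)) (at t)"
    unfolding hol_param_def by metis
  show ?thesis
    unfolding hol_param_def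
  proof (intro conjI exI allI)
    fix x t show "((\<lambda>t. f (x, t) * g (x, t)) has_field_derivative
        (\<lambda>y. f' y * g y + g' y * f y) (x, t)) (at t)"
      by (intro DERIV_mult fg)
  qed (intro continuous_intros fg)+
qed

lemma hol_param_sum: "(\<And>i. i \<in> I \<Longrightarrow> hol_param (f i)) \<Longrightarrow> hol_param (\<lambda>y. \<Sum>i\<in>I. f i y)"
  by (induction I rule: infinite_finite_induct) (auto intro: hol_param_const hol_param_add)

lemma hol_param_prod: "(\<And>i. i \<in> I \<Longrightarrow> hol_param (f i)) \<Longrightarrow> hol_param (\<lambda>y. \<Prod>i\<in>I. f i y)"
  by (induction I rule: infinite_finite_induct) (auto intro: hol_param_const hol_param_mult)

lemma hol_param_power: "hol_param f \<Longrightarrow> hol_param (\<lambda>y. f y ^ n)"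
  by (induction n) (auto intro: hol_param_const hol_param_mult)

text \<open>Freezing the first argument at \<open>x\<close> frees its slot for the integration
  variable \<open>z\<close> of a contour integral.\<close>

lemma hol_param_fix:
  assumes "hol_param g" shows "hol_param (\<lambda>y. g (x, snd y))"
proof -
  from assms obtain g' where g: "continuous_on UNIV g" "continuous_on UNIV g'"
      "\<And>x t. ((\<lambda>t. g (x, t)) has_field_derivative g' (x, t)) (at t)"
    unfolding hol_param_def by metis
  show ?thesis
    unfolding hol_param_def
  proof (intro conjI exI allI)
    show "continuous_on UNIV (\<lambda>y. g (x, snd y))"
      by (intro continuous_on_compose2[OF g(1)] continuous_intros) auto
    show "continuous_on UNIV (\<lambda>y. g' (x, snd y))"
      by (intro continuous_on_compose2[OF g(2)] continuous_intros) auto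
  qed (use g in simp)
qed

lemma holomorphic_on_contour_integral_quotient:
  fixes n e :: "complex \<times> complex \<Rightarrow> complex"
  assumes "hol_param n" "hol_param e" "open U" "0 \<le> r"
    and nz: "\<And>z t. dist c z = r \<Longrightarrow> t \<in> U \<Longrightarrow> e (z, t) \<noteq> 0"
  shows "(\<lambda>t. contour_integral (circlepath c r) (\<lambda>z. n (z, t) / e (z, t))) holomorphic_on U"
proof -
  from assms obtain n' e' where ne: "continuous_on UNIV n" "continuous_on UNIV n'"
      "continuous_on UNIV e" "continuous_on UNIV e'"
      "\<And>x t. ((\<lambda>t. n (x, t)) has_field_derivative n' (x, t)) (at t)"
      "\<And>x t. ((\<lambda>t. e (x, t)) has_field_derivative e' (x, t)) (at t)"
    unfolding hol_param_def by metis
  define h where "h = (\<lambda>s. vector_derivative (circlepath c r) (at s))"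
  define \<gamma> where "\<gamma> = circlepath c r"
  have h: "continuous_on UNIV h"
    unfolding h_def vector_derivative_circlepath by (intro continuous_intros)
  have \<gamma>: "continuous_on UNIV \<gamma>"
    unfolding \<gamma>_def circlepath by (intro continuous_intros)
  have \<gamma>s: "dist c (\<gamma> s) = r" for s
    using assms(4) by (simp add: \<gamma>_def circlepath dist_norm norm_mult mult.assoc)
  define f where "f = (\<lambda>t s. n (\<gamma> s, t) / e (\<gamma> s, t) * h s)"
  define fx where "fx = (\<lambda>t s. (n' (\<gamma> s, t) * e (\<gamma> s, t) - n (\<gamma> s, t) * e' (\<gamma> s, t)) / (e (\<gamma> s, t) * e (\<gamma> s, t)) * h s)"
  note ci = continuous_on_compose2[OF ne(1)] continuous_on_compose2[OF ne(2)]
    continuous_on_compose2[OF ne(3)] continuous_on_compose2[OF ne(4)]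
    continuous_on_compose2[OF h] continuous_on_compose2[OF \<gamma>]
  \<comment> \<open>The Leibniz rule asks for a convex domain, whereas \<open>U\<close> will be a
    punctured disc. Holomorphy is local, so balls inside \<open>U\<close> suffice.\<close>
  have loc: "(\<lambda>t. integral (cbox 0 1) (f t)) holomorphic_on ball t0 \<epsilon>" if "ball t0 \<epsilon> \<subseteq> U" for t0 \<epsilon>
  proof (rule leibniz_rule_holomorphic)
    show "((\<lambda>t. f t s) has_field_derivative fx t s) (at t within ball t0 \<epsilon>)"
      if "t \<in> ball t0 \<epsilon>" for t s
      unfolding f_def fx_def
      by (intro DERIV_cmult_right DERIV_divide has_field_derivative_at_within[OF ne(5)]
          has_field_derivative_at_within[OF ne(6)] nz \<gamma>s) (use that \<open>ball t0 \<epsilon> \<subseteq> U\<close> in auto)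
    show "f t integrable_on cbox 0 1" if "t \<in> ball t0 \<epsilon>" for t
      unfolding f_def by (intro integrable_continuous continuous_intros ci nz \<gamma>s)
        (use that \<open>ball t0 \<epsilon> \<subseteq> U\<close> nz \<gamma>s in auto)
    have "continuous_on (ball t0 \<epsilon> \<times> cbox 0 1) (\<lambda>x. fx (fst x) (snd x))"
      unfolding fx_def by (intro continuous_intros ci) (use \<open>ball t0 \<epsilon> \<subseteq> U\<close> nz \<gamma>s in auto)
    then show "continuous_on (ball t0 \<epsilon> \<times> cbox 0 1) (\<lambda>(x, t). fx x t)"
      by (simp add: split_beta)
  qed auto
  have "(\<lambda>t. integral (cbox 0 1) (f t)) holomorphic_on U"
  proof (rule holomorphic_onI)
    fix t0 assume "t0 \<in> U"
    then obtain \<epsilon> where "\<epsilon> > 0" "ball t0 \<epsilon> \<subseteq> U" using \<open>open U\<close> openE by blast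
    with loc have "(\<lambda>t. integral (cbox 0 1) (f t)) field_differentiable at t0"
      using holomorphic_on_imp_differentiable_at[of _ "ball t0 \<epsilon>" t0] by auto
    then show "(\<lambda>t. integral (cbox 0 1) (f t)) field_differentiable at t0 within U"
      by (rule field_differentiable_at_within)
  qed
  then show ?thesis
    by (simp add: contour_integral_integral f_def \<gamma>_def h_def)
qed

lemma hol_param_poly:
  assumes "poly_family d A" "\<And>k. hol_param (\<lambda>y. coeff (A y) k)"
  shows "hol_param (\<lambda>y. poly (A (x, snd y)) (fst y))"
proof -
  have "(\<lambda>y. poly (A (x, snd y)) (fst y)) = (\<lambda>y. \<Sum>k\<le>d. coeff (A (x, snd y)) k * fst y ^ k)"
    using assms(1) by (auto simp: poly_family_def fun_eq_iff intro!: poly_eq_sum_le)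
  moreover have "hol_param (\<lambda>y. coeff (A (x, snd y)) k * fst y ^ k)" for k
    by (intro hol_param_mult hol_param_fix[OF assms(2)] hol_param_power hol_param_fst[of "\<lambda>z. z"] continuous_intros)
  ultimately show ?thesis by (simp add: hol_param_sum)
qed

lemma hol_param_coeff_pderiv:
  assumes "\<And>k. hol_param (\<lambda>y. coeff (A y) k)"
  shows "hol_param (\<lambda>y. coeff (pderiv (A y)) k)"
  unfolding coeff_pderiv by (intro hol_param_mult hol_param_const assms)

section \<open>Compactness, sums over multisets, and isolated roots\<close>

lemma nonzero_near_compact:
  fixes h :: "'a::metric_space \<times> 'b::topological_space \<Rightarrow> complex"
  assumes "continuous_on UNIV h" "compact K" "\<And>z. z \<in> K \<Longrightarrow> h (y, z) \<noteq> 0"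
  obtains e where "e > 0" "\<And>y' z. dist y y' < e \<Longrightarrow> z \<in> K \<Longrightarrow> h (y', z) \<noteq> 0"
proof -
  have "open (h -` (-{0}))"
    using assms(1) by (intro open_vimage) auto
  moreover have "{y} \<times> K \<subseteq> h -` (-{0})"
    using assms(3) by auto
  ultimately obtain X where X: "y \<in> X" "open X" "X \<times> K \<subseteq> h -` (-{0})"
    using Elementary_Topology.tube_lemma[OF assms(2)] by blast
  then obtain e where e: "e > 0" "ball y e \<subseteq> X" using openE by blast
  show ?thesis
  proof (rule that[OF e(1)])
    fix y' z assume "dist y y' < e" "z \<in> K"
    then have "(y', z) \<in> X \<times> K" using e by auto
    with X(3) show "h (y', z) \<noteq> 0" by auto
  qed
qed

lemma norm_sum_mset_le:
  fixes g :: "'a \<Rightarrow> 'b::real_normed_vector"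
  assumes "\<And>w. w \<in># M \<Longrightarrow> norm (g w) \<le> C"
  shows "norm (\<Sum>w\<in>#M. g w) \<le> of_nat (size M) * C"
  using assms
proof (induction M)
  case (add x M)
  have "norm (g x + (\<Sum>w\<in>#M. g w)) \<le> C + of_nat (size M) * C"
    using add by (intro norm_triangle_mono) auto
  then show ?case by (simp add: algebra_simps)
qed auto

lemma sum_mset_diff_const:
  fixes g :: "'a \<Rightarrow> 'b::ring_1"
  shows "(\<Sum>w\<in>#M. g w - a) = (\<Sum>w\<in>#M. g w) - of_nat (size M) * a"
  by (induction M) (auto simp: algebra_simps)

lemma isolated_poly_root:
  fixes p :: "complex poly"
  assumes "p \<noteq> 0"
  obtains \<rho> where "\<rho> > 0" "\<And>z. poly p z = 0 \<Longrightarrow> dist c z \<le> \<rho> \<Longrightarrow> z = c"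
proof -
  obtain e where "e > 0" "\<forall>z\<in>{z. poly p z = 0}. z \<noteq> c \<longrightarrow> e \<le> dist c z"
    using finite_set_avoid[OF poly_roots_finite[OF assms]] by metis
  then show ?thesis by (intro that[of "e / 2"]) force+
qed

lemma disc_roots_eq_replicate:
  assumes "p \<noteq> 0" "dist c z < r" "\<And>w. poly p w = 0 \<Longrightarrow> dist c w < r \<Longrightarrow> w = z"
  shows "disc_roots c r p = replicate_mset (order z p) z"
proof (rule multiset_eqI)
  fix w show "count (disc_roots c r p) w = count (replicate_mset (order z p) z) w"
    using assms(1,2) assms(3)[of w] order_root[of p w] by (auto simp: disc_roots_def)
qed

text \<open>A count: the order at \<open>z\<close> already exhausts all roots in the disc, so none
  is left for another point.\<close>

lemma disc_roots_eq_of_size: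
  assumes "p \<noteq> 0" "dist c z < r" "size (disc_roots c r p) \<le> order z p" "poly p w = 0" "dist c w < r"
  shows "w = z"
proof (rule ccontr)
  assume "w \<noteq> z"
  have "replicate_mset (order z p) z + {#w#} \<subseteq># disc_roots c r p"
  proof (rule mset_subset_eqI)
    fix v show "count (replicate_mset (order z p) z + {#w#}) v \<le> count (disc_roots c r p) v"
      using assms \<open>w \<noteq> z\<close> order_root[of p w] by (auto simp: disc_roots_def Suc_le_eq)
  qed
  from size_mset_mono[OF this] assms(3) show False by simp
qed

lemma disc_rootsD:
  assumes "w \<in># disc_roots c r p" shows "poly p w = 0" "dist c w < r" "p \<noteq> 0"
proof -
  show "p \<noteq> 0" using assms by (auto simp: disc_roots_def)
  then show "poly p w = 0" "dist c w < r" using assms by (auto simp: disc_roots_def)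
qed

section \<open>Persistence of a common root\<close>

text \<open>In use, \<open>A\<close>, \<open>B\<close> and \<open>V\<close> are \<open>P\<close>,
  \<open>Q\<close> and a Bezout cofactor restricted to complex lines in an affine chart, and
  \<open>F\<close> is the resultant. The proof finds a constant \<open>D\<close> independent of
  \<open>x\<close> such that a nonzero value of \<open>B\<close> at \<open>\<zeta> x\<close> has
  modulus at least \<open>1 / D\<close>. Near a zero of \<open>B\<close> the modulus is smaller, so
  the value must be zero.\<close>

lemma common_root_persists:
  fixes A B V :: "'x::euclidean_space \<times> complex \<Rightarrow> complex poly"
  assumes A: "poly_family d A" "\<And>k. hol_param (\<lambda>y. coeff (A y) k)"
    and B: "poly_family d B"
    and V: "poly_family d V" "\<And>k. hol_param (\<lambda>y. coeff (V y) k)"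
    and F: "hol_param F"
    and bez: "\<And>y z. poly (A y) z = 0 \<Longrightarrow> poly (V y) z * poly (B y) z = F y"
    and x0: "x0 \<in> S" and R: "0 < R" and \<delta>: "0 < \<delta>"
    and Fnz: "\<And>x t. x \<in> S \<Longrightarrow> dist x0 x < \<delta> \<Longrightarrow> t \<noteq> 0 \<Longrightarrow> norm t < R \<Longrightarrow> F (x, t) \<noteq> 0"
    and A0: "\<And>x. x \<in> S \<Longrightarrow> A (x, 0) \<noteq> 0"
    and ord: "\<And>x. x \<in> S \<Longrightarrow> dist x0 x < \<delta> \<Longrightarrow> order (\<zeta> x) (A (x, 0)) = m" and m: "0 < m"
    and \<zeta>: "\<And>e. e > 0 \<Longrightarrow> \<exists>\<eta>>0. \<forall>x\<in>S. dist x0 x < \<eta> \<longrightarrow> dist (\<zeta> x0) (\<zeta> x) < e"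
    and b0: "poly (B (x0, 0)) (\<zeta> x0) = 0"
  shows "\<exists>\<eta>>0. \<forall>x\<in>S. dist x0 x < \<eta> \<longrightarrow> poly (B (x, 0)) (\<zeta> x) = 0"
proof -
  define c where "c = \<zeta> x0"
  have contA: "continuous_on UNIV (\<lambda>(y, z). poly (A y) z)"
    and contB: "continuous_on UNIV (\<lambda>(y, z). poly (B y) z)"
    and contV: "continuous_on UNIV (\<lambda>(y, z). poly (V y) z)"
    using A B V by (auto intro: continuous_on_poly_family)
  have contF: "continuous_on UNIV F" using F by (simp add: hol_param_def)
  obtain \<rho> where \<rho>: "\<rho> > 0" "\<And>z. poly (A (x0, 0)) z = 0 \<Longrightarrow> dist c z \<le> \<rho> \<Longrightarrow> z = c"
    using isolated_poly_root[OF A0[OF x0]] by blast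
  \<comment> \<open>No root crosses the circle of radius \<open>\<rho>\<close> while the parameter
    stays within \<open>\<epsilon>\<close> of \<open>(x0, 0)\<close>, so the number of roots inside
    it stays equal to \<open>m\<close>.\<close>
  obtain \<epsilon> where \<epsilon>: "\<epsilon> > 0" "\<And>y z. dist (x0, 0) y < \<epsilon> \<Longrightarrow> dist c z = \<rho> \<Longrightarrow> poly (A y) z \<noteq> 0"
  proof (rule nonzero_near_compact[OF contA, of "sphere c \<rho>" "(x0, 0)"])
    show "(case ((x0, 0), z) of (y, z) \<Rightarrow> poly (A y) z) \<noteq> 0" if "z \<in> sphere c \<rho>" for z
      using \<rho>(1) \<rho>(2)[of z] that by auto
  qed (auto intro: that)
  \<comment> \<open>Splitting \<open>\<epsilon>\<close> evenly between \<open>x\<close> and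
    \<open>t\<close> keeps \<open>(x, t)\<close> in the ball. The singularity at
    \<open>t = 0\<close> will be removed in the disc of radius \<open>r'\<close>, and the bound is
    taken on the smaller circle of radius \<open>r\<close>.\<close>
  define r' where "r' = min R (\<epsilon> / 2)"
  define r where "r = r' / 2"
  have r: "0 < r" "r < r'" "r' \<le> R" "r' \<le> \<epsilon> / 2"
    using R \<epsilon>(1) by (auto simp: r_def r'_def)
  have size: "size (disc_roots c \<rho> (A y)) = m" if "dist (x0, 0) y < \<epsilon>" for y
  proof -
    have "size (disc_roots c \<rho> (A y)) = size (disc_roots c \<rho> (A (x0, 0)))"
      using \<epsilon> that \<rho>(1) by (intro size_disc_roots_constant[OF A(1), of "ball (x0, 0) \<epsilon>"]) auto
    also have "disc_roots c \<rho> (A (x0, 0)) = replicate_mset (order c (A (x0, 0))) c"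
      using \<rho> A0[OF x0] by (intro disc_roots_eq_replicate) auto
    finally show ?thesis using ord[OF x0] \<delta> by (simp add: c_def)
  qed
  have near: "dist (x0, 0) (x, t) < \<epsilon>" if "dist x0 x < \<epsilon> / 2" "norm t < r'" for x and t :: complex
  proof -
    have "dist (x0, 0) (x, t) \<le> dist x0 x + dist 0 t"
      by (simp add: dist_Pair_Pair sqrt_sum_squares_le_sum)
    then show ?thesis using that r by simp
  qed
  \<comment> \<open>On the circle \<open>norm t = r\<close> the nonvanishing of \<open>F\<close> at
    \<open>x0\<close> extends to all nearby \<open>x\<close>, on or off \<open>S\<close>. Hence
    \<open>K\<close> below can use a full closed ball, is compact, and yields the bound
    \<open>D\<close> uniformly in \<open>x\<close>.\<close>
  obtain \<epsilon>1 where \<epsilon>1: "\<epsilon>1 > 0" "\<And>x t. dist x0 x < \<epsilon>1 \<Longrightarrow> norm t = r \<Longrightarrow> F (x, t) \<noteq> 0"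
  proof (rule nonzero_near_compact[OF contF, of "sphere 0 r" x0])
    show "F (x0, t) \<noteq> 0" if "t \<in> sphere 0 r" for t
      using Fnz[OF x0, of t] \<delta> r that by auto
  qed (auto intro: that)
  define K where "K = cball x0 (\<epsilon>1 / 2) \<times> sphere (0::complex) r \<times> cball c \<rho>"
  have "compact K" unfolding K_def by (intro compact_Times) auto
  have "continuous_on K (\<lambda>k. (\<lambda>(y, z). poly (V y) z) ((fst k, fst (snd k)), snd (snd k)) / F (fst k, fst (snd k)))"
    using \<epsilon>1 by (intro continuous_on_divide continuous_on_compose2[OF contV] continuous_on_compose2[OF contF]
        continuous_intros) (auto simp: K_def)
  from compact_imp_bounded[OF compact_continuous_image[OF this \<open>compact K\<close>]]
  obtain D where D: "D > 0" "\<And>k. k \<in> K \<Longrightarrow> norm (poly (V (fst k, fst (snd k))) (snd (snd k)) / F (fst k, fst (snd k))) \<le> D"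
    unfolding bounded_pos by auto
  have VF: "norm (poly (V (x, t)) z / F (x, t)) \<le> D" if "dist x0 x < \<epsilon>1 / 2" "norm t = r" "dist c z < \<rho>" for x t z
    using D(2)[of "(x, t, z)"] that by (auto simp: K_def)
  have "continuous_on UNIV (\<lambda>k. (\<lambda>(y, z). poly (B y) z) ((fst k, 0), snd k))"
    by (intro continuous_on_compose2[OF contB] continuous_intros) auto
  then have "isCont (\<lambda>k. (\<lambda>(y, z). poly (B y) z) ((fst k, 0), snd k)) (x0, c)"
    using continuous_on_eq_continuous_at[OF open_UNIV] by blast
  \<comment> \<open>The threshold \<open>1 / D\<close> is the one that the maximum principle will
    contradict at the end.\<close>
  then obtain e where e: "e > 0" "\<And>x z. dist (x, z) (x0, c) < e \<Longrightarrow> norm (poly (B (x, 0)) z) < 1 / D"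
    using b0 D(1) unfolding continuous_at_eps_delta
    by (elim allE[of _ "1 / D"]) (auto simp: c_def)
  obtain \<eta>' where \<eta>': "\<eta>' > 0" "\<And>x. x \<in> S \<Longrightarrow> dist x0 x < \<eta>' \<Longrightarrow> dist c (\<zeta> x) < min \<rho> (e / 2)"
    using \<zeta>[of "min \<rho> (e / 2)"] \<rho>(1) e(1) unfolding c_def by auto
  define \<eta> where "\<eta> = Min {\<eta>', \<delta>, \<epsilon> / 2, \<epsilon>1 / 2, e / 2}"
  have \<eta>: "\<eta> > 0" "\<eta> \<le> \<eta>'" "\<eta> \<le> \<delta>" "\<eta> \<le> \<epsilon> / 2" "\<eta> \<le> \<epsilon>1 / 2" "\<eta> \<le> e / 2"
    using \<eta>'(1) \<delta> \<epsilon>(1) \<epsilon>1(1) e(1) by (auto simp: \<eta>_def)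
  show ?thesis
  proof (intro exI[of _ \<eta>] conjI ballI impI \<eta>(1), rule ccontr)
    fix x assume x: "x \<in> S" "dist x0 x < \<eta>" and b: "poly (B (x, 0)) (\<zeta> x) \<noteq> 0"
    define b where "b = poly (B (x, 0)) (\<zeta> x)"
    define z0 where "z0 = \<zeta> x"
    have z0: "dist c z0 < \<rho>" "dist c z0 < e / 2" using \<eta>'(2)[OF x(1)] x \<eta> by (auto simp: z0_def)
    have bsmall: "norm b < 1 / D"
    proof -
      have "dist (x, z0) (x0, c) \<le> dist x x0 + dist z0 c"
        by (simp add: dist_Pair_Pair sqrt_sum_squares_le_sum)
      then show ?thesis using e(2)[of x z0] x z0 \<eta> by (simp add: b_def z0_def dist_commute)
    qed
    define M where "M = (\<lambda>t. disc_roots c \<rho> (A (x, t)))"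
    have sizeM: "size (M t) = m" if "norm t < r'" for t
      unfolding M_def using near[of x t] that x \<eta> by (intro size) auto
    \<comment> \<open>At \<open>t = 0\<close> the disc holds exactly \<open>m\<close> roots with
      multiplicity, and \<open>m\<close> is the order of \<open>z0\<close> alone. The boundary
      circle carries no root by the choice of \<open>\<epsilon>\<close>.\<close>
    have only: "z = z0" if "poly (A (x, 0)) z = 0" "dist c z \<le> \<rho>" for z
    proof -
      have "dist c z \<noteq> \<rho>" using \<epsilon>(2)[of "(x, 0)" z] near[of x 0] that x \<eta> r by auto
      with that show ?thesis
        using disc_roots_eq_of_size[OF A0[OF x(1)] z0(1), of z] sizeM[of 0] ord[OF x(1)] x \<eta> r
        by (auto simp: M_def z0_def)
    qed
    have Fx: "F (x, t) \<noteq> 0" if "t \<noteq> 0" "norm t < r'" for t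
      using Fnz[OF x(1), of t] that x \<eta> r by auto
    have Ax: "poly (A (x, t)) z \<noteq> 0" if "norm t < r'" "dist c z = \<rho>" for t z
      using near[of x t] that x \<eta> by (intro \<epsilon>(2)) auto
    (* On roots of A the summand is 1 / B; written as V / F it is entire in the root, so that the sum
       is a contour integral. *)
    define f where "f = (\<lambda>t. \<Sum>w\<in>#M t. poly (V (x, t)) w / F (x, t))"
    have fB: "f t = (\<Sum>w\<in>#M t. 1 / poly (B (x, t)) w)" if "t \<noteq> 0" "norm t < r'" for t
      unfolding f_def
    proof (intro arg_cong[of _ _ sum_mset] image_mset_cong)
      fix w assume "w \<in># M t"
      then have "poly (V (x, t)) w * poly (B (x, t)) w = F (x, t)"
        by (intro bez) (auto simp: M_def dest: disc_rootsD)
      moreover from this Fx[OF that] have "poly (B (x, t)) w \<noteq> 0" by auto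
      ultimately show "poly (V (x, t)) w / F (x, t) = 1 / poly (B (x, t)) w"
        using Fx[OF that] by (simp add: field_simps)
    qed
    \<comment> \<open>The denominator \<open>F * A\<close> of the integrand has no zero for
      \<open>z\<close> on the circle and \<open>0 < norm t < r'\<close>, so the contour integral is
      holomorphic there.\<close>
    have hol: "f holomorphic_on ball 0 r' - {0}"
    proof -
      define n where "n = (\<lambda>y. poly (V (x, snd y)) (fst y) * poly (pderiv (A (x, snd y))) (fst y))"
      define q where "q = (\<lambda>y. F (x, snd y) * poly (A (x, snd y)) (fst y))"
      have "hol_param n"
        unfolding n_def
        by (intro hol_param_mult hol_param_poly[OF V(1) V(2)]
            hol_param_poly[OF poly_family_pderiv[OF A(1)] hol_param_coeff_pderiv[OF A(2)]])
      moreover have "hol_param q"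
        unfolding q_def by (intro hol_param_mult hol_param_poly[OF A(1) A(2)] hol_param_fix[OF F])
      ultimately have "(\<lambda>t. contour_integral (circlepath c \<rho>) (\<lambda>z. n (z, t) / q (z, t))) holomorphic_on ball 0 r' - {0}"
        using \<rho>(1) Fx Ax
        by (intro holomorphic_on_contour_integral_quotient) (auto simp: q_def)
      then have "(\<lambda>t. contour_integral (circlepath c \<rho>) (\<lambda>z. n (z, t) / q (z, t)) / (2 * complex_of_real pi * \<i>))
          holomorphic_on ball 0 r' - {0}"
        by (intro holomorphic_intros) auto
      moreover have "contour_integral (circlepath c \<rho>) (\<lambda>z. n (z, t) / q (z, t)) / (2 * complex_of_real pi * \<i>) = f t"
        if "t \<in> ball 0 r' - {0}" for t
      proof -
        have "contour_integral (circlepath c \<rho>) (\<lambda>z. poly (V (x, t)) z / F (x, t) * poly (pderiv (A (x, t))) z / poly (A (x, t)) z) =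
           2 * complex_of_real pi * \<i> * (\<Sum>w\<in>#disc_roots c \<rho> (A (x, t)). poly (V (x, t)) w / F (x, t))"
          using that Ax \<rho>(1) Fx[of t]
          by (intro contour_integral_disc_roots) (auto intro!: holomorphic_intros)
        moreover have "(\<lambda>z. n (z, t) / q (z, t)) =
            (\<lambda>z. poly (V (x, t)) z / F (x, t) * poly (pderiv (A (x, t))) z / poly (A (x, t)) z)"
          by (simp add: n_def q_def)
        ultimately have "contour_integral (circlepath c \<rho>) (\<lambda>z. n (z, t) / q (z, t)) = 2 * complex_of_real pi * \<i> * f t"
          by (simp only: f_def M_def)
        then show ?thesis by simp
      qed
      ultimately show ?thesis by (subst holomorphic_cong[OF refl, symmetric]) auto
    qed
    \<comment> \<open>As \<open>t\<close> tends to 0, all \<open>m\<close> roots in the disc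
      converge to \<open>z0\<close>, the only root at \<open>t = 0\<close>, so each of the
      \<open>m\<close> summands tends to \<open>1 / b\<close>.\<close>
    have lim: "(f \<longlongrightarrow> of_nat m / b) (at 0)"
    proof (rule LIM_I)
      fix e' :: real assume "e' > 0"
      have "continuous_on UNIV (\<lambda>k. (\<lambda>(y, z). poly (B y) z) ((x, fst k), snd k))"
        by (intro continuous_on_compose2[OF contB] continuous_intros) auto
      then have "isCont (\<lambda>k. (\<lambda>(y, z). poly (B y) z) ((x, fst k), snd k)) (0, z0)"
        using continuous_on_eq_continuous_at[OF open_UNIV] by blast
      then have "isCont (\<lambda>k. 1 / (\<lambda>(y, z). poly (B y) z) ((x, fst k), snd k)) (0, z0)"
        using b by (intro isCont_divide) (auto simp: z0_def)
      then obtain s where s: "s > 0"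
        "\<And>t z. dist (t, z) (0, z0) < s \<Longrightarrow> norm (1 / poly (B (x, t)) z - 1 / b) < e' / (2 * m)"
        using \<open>e' > 0\<close> m unfolding continuous_at_eps_delta
        by (elim allE[of _ "e' / (2 * m)"]) (auto simp: b_def z0_def dist_norm)
      \<comment> \<open>On the closed disc with a small ball about \<open>z0\<close> removed,
        \<open>A (x, 0)\<close> has no root. By compactness the same holds for small
        \<open>t\<close>, which traps the roots near \<open>z0\<close>.\<close>
      obtain s' where s': "s' > 0" "\<And>t z. dist 0 t < s' \<Longrightarrow> z \<in> cball c \<rho> - ball z0 (s / 2) \<Longrightarrow> poly (A (x, t)) z \<noteq> 0"
      proof -
        have "continuous_on UNIV (\<lambda>k. (\<lambda>(y, z). poly (A y) z) ((x, fst k), snd k))"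
          by (intro continuous_on_compose2[OF contA] continuous_intros) auto
        then show ?thesis
        proof (rule nonzero_near_compact[of _ "cball c \<rho> - ball z0 (s / 2)" 0])
          show "(case ((x, fst (0, z)), snd (0, z)) of (y, z) \<Rightarrow> poly (A y) z) \<noteq> 0"
            if "z \<in> cball c \<rho> - ball z0 (s / 2)" for z
            using only[of z] s(1) that by auto
        qed (auto intro: that compact_diff)
      qed
      show "\<exists>s>0. \<forall>t. t \<noteq> 0 \<and> norm (t - 0) < s \<longrightarrow> norm (f t - of_nat m / b) < e'"
      proof (intro exI[of _ "Min {s / 2, s', r'}"] conjI allI impI)
        show "0 < Min {s / 2, s', r'}" using s s' r by auto
        fix t :: complex assume "t \<noteq> 0 \<and> norm (t - 0) < Min {s / 2, s', r'}"
        then have t: "t \<noteq> 0" "norm t < s / 2" "norm t < s'" "norm t < r'" by auto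
        have "f t - of_nat m / b = (\<Sum>w\<in>#M t. 1 / poly (B (x, t)) w - 1 / b)"
          using fB t sizeM[of t] by (simp add: sum_mset_diff_const)
        also have "norm \<dots> \<le> of_nat (size (M t)) * (e' / (2 * m))"
        proof (rule norm_sum_mset_le)
          fix w assume "w \<in># M t"
          then have w: "poly (A (x, t)) w = 0" "dist c w < \<rho>" by (auto simp: M_def dest: disc_rootsD)
          then have "dist z0 w < s / 2" using s'(2)[of t w] t by auto
          moreover have "dist (t, w) (0, z0) \<le> dist t 0 + dist w z0"
            by (simp add: dist_Pair_Pair sqrt_sum_squares_le_sum)
          ultimately show "norm (1 / poly (B (x, t)) w - 1 / b) \<le> e' / (2 * m)"
            using s(2)[of t w] t by (simp add: dist_commute)
        qed
        also have "\<dots> < e'" using sizeM[of t] t m \<open>e' > 0\<close> by simp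
        finally show "norm (f t - of_nat m / b) < e'" .
      qed
    qed
    define g where "g = (\<lambda>t. if t = 0 then of_nat m / b else f t)"
    have "(g \<longlongrightarrow> of_nat m / b) (at 0)"
      by (rule Lim_transform_eventually[OF lim]) (auto simp: g_def eventually_at_filter)
    then have lim_g: "(g \<longlongrightarrow> g 0) (at 0 within ball 0 r')"
      using Lim_at_imp_Lim_at_within by (simp add: g_def)
    have g: "g holomorphic_on ball 0 r'"
    proof (rule no_isolated_singularity'[of "{0}"])
      show "(g \<longlongrightarrow> g z) (at z within ball 0 r')" if "z \<in> {0}" for z
        using lim_g that by simp
      show "g holomorphic_on ball 0 r' - {0}"
        using hol by (rule holomorphic_transform) (auto simp: g_def)
    qed auto
    \<comment> \<open>Maximum modulus: on the circle of radius \<open>r\<close> each of the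
      \<open>m\<close> summands has modulus at most \<open>D\<close>, and the value at the centre is
      \<open>m / b\<close>.\<close>
    have "norm (g 0) \<le> of_nat m * D"
    proof (rule maximum_modulus_frontier[of g "ball 0 r"])
      show "g holomorphic_on interior (ball 0 r)"
        using r by (intro holomorphic_on_subset[OF g]) auto
      show "continuous_on (closure (ball 0 r)) g"
        using r by (intro holomorphic_on_imp_continuous_on holomorphic_on_subset[OF g]) auto
      show "norm (g z) \<le> of_nat m * D" if "z \<in> frontier (ball 0 r)" for z
      proof -
        have z: "norm z = r" "z \<noteq> 0" using that r by auto
        have "norm (f z) \<le> of_nat (size (M z)) * D"
          unfolding f_def
          by (intro norm_sum_mset_le VF) (use z x \<eta> in \<open>auto simp: M_def dest: disc_rootsD\<close>)
        then show ?thesis using z r sizeM[of z] by (simp add: g_def)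
      qed
    qed (use r in auto)
    then have "of_nat m / norm b \<le> of_nat m * D"
      by (simp add: g_def norm_divide)
    then have "1 \<le> D * norm b" using b m by (simp add: b_def field_simps)
    with bsmall D(1) show False by (simp add: field_simps)
  qed
qed

section \<open>Complex evaluation and Taylor expansion of multivariate polynomials\<close>

definition ceval :: "('m::finite \<Rightarrow> complex) \<Rightarrow> 'm mpoly \<Rightarrow> complex" where
  "ceval z p = (\<Sum>\<alpha>\<in>Poly_Mapping.keys p. of_real (Poly_Mapping.lookup p \<alpha>) * (\<Prod>i\<in>UNIV. z i ^ Poly_Mapping.lookup \<alpha> i))"

lemma of_real_mpeval: "of_real (mpeval p x) = ceval (\<lambda>i. of_real (vec_nth x i)) p"
  unfolding mpeval_def ceval_def by simp

lemma ceval_superset: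
  assumes "finite A" "Poly_Mapping.keys p \<subseteq> A"
  shows "ceval z p = (\<Sum>\<alpha>\<in>A. of_real (Poly_Mapping.lookup p \<alpha>) * (\<Prod>i\<in>UNIV. z i ^ Poly_Mapping.lookup \<alpha> i))"
  unfolding ceval_def
  by (intro sum.mono_neutral_left) (use assms in \<open>auto simp: in_keys_iff\<close>)

lemma ceval_zero [simp]: "ceval z 0 = 0"
  by (simp add: ceval_def)

lemma ceval_add: "ceval z (p + q) = ceval z p + ceval z q"
proof -
  let ?A = "Poly_Mapping.keys p \<union> Poly_Mapping.keys q"
  have "Poly_Mapping.keys (p + q) \<subseteq> ?A" by (rule Poly_Mapping.keys_add)
  then show ?thesis
    using ceval_superset[of ?A "p + q" z] ceval_superset[of ?A p z] ceval_superset[of ?A q z]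
    by (simp add: lookup_add distrib_right sum.distrib)
qed

lemma ceval_sum: "ceval z (\<Sum>i\<in>I. f i) = (\<Sum>i\<in>I. ceval z (f i))"
  by (induction I rule: infinite_finite_induct) (auto simp: ceval_add)

lemma ceval_single:
  "ceval z (Poly_Mapping.single \<alpha> c) = of_real c * (\<Prod>i\<in>UNIV. z i ^ Poly_Mapping.lookup \<alpha> i)"
  by (simp add: ceval_superset[of "{\<alpha>}"])

lemma poly_mapping_eq_sum_single:
  "p = (\<Sum>\<alpha>\<in>Poly_Mapping.keys p. Poly_Mapping.single \<alpha> (Poly_Mapping.lookup p \<alpha>))"
  by (rule poly_mapping_eqI) (auto simp: lookup_sum lookup_single when_def in_keys_iff)

lemma ceval_mult: "ceval z (p * q) = ceval z p * ceval z q"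
proof -
  have "ceval z (p * q) = ceval z ((\<Sum>\<alpha>\<in>Poly_Mapping.keys p. Poly_Mapping.single \<alpha> (Poly_Mapping.lookup p \<alpha>)) *
      (\<Sum>\<alpha>\<in>Poly_Mapping.keys q. Poly_Mapping.single \<alpha> (Poly_Mapping.lookup q \<alpha>)))"
    using poly_mapping_eq_sum_single by metis
  also have "\<dots> = ceval z p * ceval z q"
    unfolding sum_product mult_single ceval_sum ceval_single unfolding ceval_def sum_product
    by (simp add: lookup_add power_add prod.distrib mult_ac)
  finally show ?thesis .
qed

lemma ceval_one [simp]: "ceval z 1 = 1"
  using ceval_single[of z 0 1] by simp

lemma comm_ring_hom_ceval: "comm_ring_hom (ceval z)"
  by unfold_locales (auto simp: ceval_add ceval_mult)

lemma lookup_Abs_finite [simp]: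
  "Poly_Mapping.lookup (Abs_poly_mapping f) = (f :: 'm::finite \<Rightarrow> 'b::zero)"
  by (simp add: Abs_poly_mapping_inverse)

lemma finite_shifted_keys: "finite {\<alpha>. \<alpha> + \<beta> \<in> Poly_Mapping.keys (p :: 'm::finite mpoly)}"
  by (rule inj_on_finite[of "\<lambda>\<alpha>. \<alpha> + \<beta>" _ "Poly_Mapping.keys p"]) (auto intro: inj_onI)

text \<open>\<open>Abs_poly_mapping\<close> is meaningful only for finitely supported functions.
  Here the support is contained in the keys of \<open>p\<close> shifted by \<open>\<beta>\<close>,
  which is finite because the shift is injective.\<close>

lemma lookup_mpdiff:
  "Poly_Mapping.lookup (mpdiff \<beta> p) \<alpha> = Poly_Mapping.lookup p (\<alpha> + \<beta>) *
      (\<Prod>i\<in>UNIV. real (fact (Poly_Mapping.lookup (\<alpha> + \<beta>) i)) / real (fact (Poly_Mapping.lookup \<alpha> i)))"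
proof -
  have "finite {\<alpha>. Poly_Mapping.lookup p (\<alpha> + \<beta>) *
      (\<Prod>i\<in>UNIV. real (fact (Poly_Mapping.lookup (\<alpha> + \<beta>) i)) / real (fact (Poly_Mapping.lookup \<alpha> i))) \<noteq> 0}"
    by (rule finite_subset[OF _ finite_shifted_keys[of \<beta> p]]) (auto simp: in_keys_iff)
  then show ?thesis unfolding mpdiff_def by (simp add: Abs_poly_mapping_inverse)
qed

lemma keys_mpdiff: "Poly_Mapping.keys (mpdiff \<beta> p) = {\<alpha>. \<alpha> + \<beta> \<in> Poly_Mapping.keys p}"
  by (auto simp: in_keys_iff lookup_mpdiff)

text \<open>The binomial theorem in each coordinate, followed by expansion of the product. A choice
  of one summand per coordinate is an exponent vector \<alpha>, and its complement in \<gamma> is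
  \<beta>.\<close>

lemma prod_power_add_binomial:
  fixes z h :: "'m::finite \<Rightarrow> complex" and \<gamma> :: "'m \<Rightarrow>\<^sub>0 nat"
  shows "(\<Prod>i\<in>UNIV. (z i + h i) ^ Poly_Mapping.lookup \<gamma> i) =
    (\<Sum>(\<alpha>, \<beta>)\<in>{(\<alpha>, \<beta>). \<alpha> + \<beta> = \<gamma>}. \<Prod>i\<in>UNIV. of_nat (Poly_Mapping.lookup \<gamma> i choose Poly_Mapping.lookup \<alpha> i) *
       z i ^ Poly_Mapping.lookup \<alpha> i * h i ^ Poly_Mapping.lookup \<beta> i)"
proof -
  have "(\<Prod>i\<in>UNIV. (z i + h i) ^ Poly_Mapping.lookup \<gamma> i) =
    (\<Prod>i\<in>UNIV. \<Sum>k\<le>Poly_Mapping.lookup \<gamma> i. of_nat (Poly_Mapping.lookup \<gamma> i choose k) * z i ^ k * h i ^ (Poly_Mapping.lookup \<gamma> i - k))"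
    by (simp add: binomial_ring)
  also have "\<dots> = (\<Sum>g\<in>Pi\<^sub>E UNIV (\<lambda>i. {..Poly_Mapping.lookup \<gamma> i}). \<Prod>i\<in>UNIV. of_nat (Poly_Mapping.lookup \<gamma> i choose g i) *
        z i ^ g i * h i ^ (Poly_Mapping.lookup \<gamma> i - g i))"
    by (intro prod_sum_PiE) auto
  also have "\<dots> = (\<Sum>(\<alpha>, \<beta>)\<in>{(\<alpha>, \<beta>). \<alpha> + \<beta> = \<gamma>}. \<Prod>i\<in>UNIV. of_nat (Poly_Mapping.lookup \<gamma> i choose Poly_Mapping.lookup \<alpha> i) *
       z i ^ Poly_Mapping.lookup \<alpha> i * h i ^ Poly_Mapping.lookup \<beta> i)"
    by (rule sum.reindex_bij_witness[of _ "\<lambda>(\<alpha>, \<beta>). Poly_Mapping.lookup \<alpha>"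
          "\<lambda>g. (Abs_poly_mapping g, Abs_poly_mapping (\<lambda>i. Poly_Mapping.lookup \<gamma> i - g i))"])
      (auto simp: lookup_add fun_eq_iff PiE_def Pi_iff intro!: poly_mapping_eqI)
  finally show ?thesis .
qed

lemma finite_antidiagonal: "finite {(\<alpha>, \<beta>). \<alpha> + \<beta> = (\<gamma> :: 'm::finite \<Rightarrow>\<^sub>0 nat)}"
proof (rule inj_on_finite[of "\<lambda>(\<alpha>, \<beta>). Poly_Mapping.lookup \<alpha>" _ "Pi\<^sub>E UNIV (\<lambda>i. {..Poly_Mapping.lookup \<gamma> i})"])
  show "inj_on (\<lambda>(\<alpha>, \<beta>). Poly_Mapping.lookup \<alpha>) {(\<alpha>, \<beta>). \<alpha> + \<beta> = \<gamma>}"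
    by (auto intro!: inj_onI simp: lookup_inject)
qed (auto simp: lookup_add intro: finite_PiE)

text \<open>The exponents dividing some monomial of \<open>p\<close>: a finite set outside which all
  derivatives vanish identically, so that the Taylor expansion is a finite sum at every
  point.\<close>

definition taylor_support :: "'m::finite mpoly \<Rightarrow> ('m \<Rightarrow>\<^sub>0 nat) set" where
  "taylor_support p = (\<Union>\<gamma>\<in>Poly_Mapping.keys p. snd ` {(\<alpha>, \<beta>). \<alpha> + \<beta> = \<gamma>})"

lemma finite_taylor_support: "finite (taylor_support p)"
  unfolding taylor_support_def using finite_antidiagonal by auto

lemma mpdiff_outside_taylor_support: "\<beta> \<notin> taylor_support p \<Longrightarrow> mpdiff \<beta> p = 0"
  unfolding keys_eq_empty[symmetric] keys_mpdiff taylor_support_def by force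

text \<open>Expand each monomial and regroup by the power of \<open>h\<close>. The factorials match
  because the binomial coefficient of \<alpha> + \<beta> over \<alpha> is the factor in
  \<open>mpdiff\<close> divided by the factorial of \<beta>.\<close>

lemma ceval_taylor:
  fixes p :: "'m::finite mpoly"
  shows "ceval (\<lambda>i. z i + h i) p = (\<Sum>\<beta>\<in>taylor_support p. ceval z (mpdiff \<beta> p) *
     (\<Prod>i\<in>UNIV. h i ^ Poly_Mapping.lookup \<beta> i / fact (Poly_Mapping.lookup \<beta> i)))"
proof -
  let ?T = "\<lambda>\<gamma> \<alpha> \<beta>. of_real (Poly_Mapping.lookup p \<gamma>) * (\<Prod>i\<in>UNIV. of_nat (Poly_Mapping.lookup \<gamma> i choose Poly_Mapping.lookup \<alpha> i) *
       z i ^ Poly_Mapping.lookup \<alpha> i * h i ^ Poly_Mapping.lookup \<beta> i)"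
  have "ceval (\<lambda>i. z i + h i) p = (\<Sum>\<gamma>\<in>Poly_Mapping.keys p. \<Sum>(\<alpha>, \<beta>)\<in>{(\<alpha>, \<beta>). \<alpha> + \<beta> = \<gamma>}. ?T \<gamma> \<alpha> \<beta>)"
    unfolding ceval_def prod_power_add_binomial by (simp add: sum_distrib_left split_beta)
  also have "\<dots> = (\<Sum>(\<gamma>, \<alpha>, \<beta>)\<in>Sigma (Poly_Mapping.keys p) (\<lambda>\<gamma>. {(\<alpha>, \<beta>). \<alpha> + \<beta> = \<gamma>}). ?T \<gamma> \<alpha> \<beta>)"
    by (subst sum.Sigma) (auto simp: finite_antidiagonal)
  also have "\<dots> = (\<Sum>(\<beta>, \<alpha>)\<in>Sigma (taylor_support p) (\<lambda>\<beta>. {\<alpha>. \<alpha> + \<beta> \<in> Poly_Mapping.keys p}). ?T (\<alpha> + \<beta>) \<alpha> \<beta>)"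
    by (rule sum.reindex_bij_witness[of _ "\<lambda>(\<beta>, \<alpha>). (\<alpha> + \<beta>, \<alpha>, \<beta>)" "\<lambda>(\<gamma>, \<alpha>, \<beta>). (\<beta>, \<alpha>)"])
      (auto simp: taylor_support_def image_iff)
  also have "\<dots> = (\<Sum>\<beta>\<in>taylor_support p. \<Sum>\<alpha>\<in>{\<alpha>. \<alpha> + \<beta> \<in> Poly_Mapping.keys p}. ?T (\<alpha> + \<beta>) \<alpha> \<beta>)"
    by (subst sum.Sigma) (auto simp: finite_taylor_support finite_shifted_keys)
  also have "\<dots> = (\<Sum>\<beta>\<in>taylor_support p. ceval z (mpdiff \<beta> p) *
     (\<Prod>i\<in>UNIV. h i ^ Poly_Mapping.lookup \<beta> i / fact (Poly_Mapping.lookup \<beta> i)))"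
  proof (intro sum.cong refl)
    fix \<beta>
    have b: "of_nat (a + b choose a) = (fact (a + b) / fact a / fact b :: complex)" for a b
      by (subst binomial_fact) auto
    show "(\<Sum>\<alpha>\<in>{\<alpha>. \<alpha> + \<beta> \<in> Poly_Mapping.keys p}. ?T (\<alpha> + \<beta>) \<alpha> \<beta>) = ceval z (mpdiff \<beta> p) *
     (\<Prod>i\<in>UNIV. h i ^ Poly_Mapping.lookup \<beta> i / fact (Poly_Mapping.lookup \<beta> i))"
      unfolding ceval_def keys_mpdiff lookup_mpdiff sum_distrib_right
    proof (intro sum.cong refl)
      fix \<alpha>
      have "(\<Prod>i\<in>UNIV. of_nat (Poly_Mapping.lookup (\<alpha> + \<beta>) i choose Poly_Mapping.lookup \<alpha> i) *
             z i ^ Poly_Mapping.lookup \<alpha> i * h i ^ Poly_Mapping.lookup \<beta> i) =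
          (\<Prod>i\<in>UNIV. of_real (real (fact (Poly_Mapping.lookup (\<alpha> + \<beta>) i)) / real (fact (Poly_Mapping.lookup \<alpha> i)))) *
          (\<Prod>i\<in>UNIV. z i ^ Poly_Mapping.lookup \<alpha> i) *
          (\<Prod>i\<in>UNIV. h i ^ Poly_Mapping.lookup \<beta> i / fact (Poly_Mapping.lookup \<beta> i))"
        unfolding prod.distrib[symmetric] by (intro prod.cong refl) (simp add: lookup_add b)
      then show "?T (\<alpha> + \<beta>) \<alpha> \<beta> = of_real (Poly_Mapping.lookup p (\<alpha> + \<beta>) *
            (\<Prod>i\<in>UNIV. real (fact (Poly_Mapping.lookup (\<alpha> + \<beta>) i)) / real (fact (Poly_Mapping.lookup \<alpha> i)))) *
          (\<Prod>i\<in>UNIV. z i ^ Poly_Mapping.lookup \<alpha> i) *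
          (\<Prod>i\<in>UNIV. h i ^ Poly_Mapping.lookup \<beta> i / fact (Poly_Mapping.lookup \<beta> i))"
        by (simp only: of_real_mult of_real_prod mult.assoc)
    qed
  qed
  finally show ?thesis .
qed

section \<open>Order of vanishing and restriction to a line\<close>

text \<open>Differentiating by a monomial of maximal total degree leaves a nonzero constant. Hence
  the \<open>LEAST\<close> in \<open>mp_ord\<close> is attained at every point.\<close>

lemma exists_mpdiff_nonzero:
  assumes "p \<noteq> 0"
  shows "\<exists>\<beta>. mpeval (mpdiff \<beta> p) v \<noteq> 0"
proof -
  let ?d = "\<lambda>\<alpha>. \<Sum>i\<in>UNIV. Poly_Mapping.lookup \<alpha> i"
  have "Poly_Mapping.keys p \<noteq> {}" using assms by simp
  then obtain \<beta> where \<beta>: "\<beta> \<in> Poly_Mapping.keys p" "\<And>\<alpha>. \<alpha> \<in> Poly_Mapping.keys p \<Longrightarrow> ?d \<alpha> \<le> ?d \<beta>"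
    using Max_in[of "?d ` Poly_Mapping.keys p"] Max_ge[of "?d ` Poly_Mapping.keys p"]
    by (metis (no_types, lifting) finite_imageI finite_keys imageE imageI image_is_empty)
  have "Poly_Mapping.keys (mpdiff \<beta> p) = {0}"
  proof -
    have "\<alpha> = 0" if "\<alpha> + \<beta> \<in> Poly_Mapping.keys p" for \<alpha>
      using \<beta>(2)[OF that] by (intro poly_mapping_eqI) (auto simp: lookup_add sum.distrib)
    with \<beta>(1) show ?thesis by (auto simp: keys_mpdiff)
  qed
  moreover from this have "Poly_Mapping.lookup (mpdiff \<beta> p) 0 \<noteq> 0" using in_keys_iff by blast
  ultimately have "mpeval (mpdiff \<beta> p) v \<noteq> 0" by (simp add: mpeval_def)
  then show ?thesis ..
qed

lemma mp_ord_eqD: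
  assumes "p \<noteq> 0" "mp_ord p v = k"
  shows "\<And>\<beta>. (\<Sum>i\<in>UNIV. Poly_Mapping.lookup \<beta> i) < k \<Longrightarrow> mpeval (mpdiff \<beta> p) v = 0"
    and "\<exists>\<beta>. (\<Sum>i\<in>UNIV. Poly_Mapping.lookup \<beta> i) = k \<and> mpeval (mpdiff \<beta> p) v \<noteq> 0"
proof -
  define W :: "nat \<Rightarrow> bool" where "W = (\<lambda>k. \<exists>\<beta>. (\<Sum>i\<in>UNIV. Poly_Mapping.lookup \<beta> i) = k \<and> mpeval (mpdiff \<beta> p) v \<noteq> 0)"
  have k: "(LEAST k. W k) = k"
    using assms(2) by (simp add: mp_ord_def W_def)
  have "W (LEAST k. W k)"
    by (rule LeastI_ex) (use exists_mpdiff_nonzero[OF assms(1), of v] in \<open>simp add: W_def\<close>)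
  then show "\<exists>\<beta>. (\<Sum>i\<in>UNIV. Poly_Mapping.lookup \<beta> i) = k \<and> mpeval (mpdiff \<beta> p) v \<noteq> 0"
    unfolding k by (simp add: W_def)
  show "mpeval (mpdiff \<beta> p) v = 0" if "(\<Sum>i\<in>UNIV. Poly_Mapping.lookup \<beta> i) < k" for \<beta>
    using not_less_Least[of "\<Sum>i\<in>UNIV. Poly_Mapping.lookup \<beta> i" W] that unfolding k
    by (auto simp: W_def)
qed

text \<open>A nonzero real polynomial has a point where it does not vanish; injectivity on
  \<open>I\<close> ensures that distinct exponents give distinct monomials. In the induction the
  monomials with the same power of variable \<open>j\<close> as \<open>b\<close> form the
  coefficient of that power. The induction hypothesis makes it nonzero, and the resulting univariate
  polynomial has a non-root.\<close>

lemma exists_nonzero_value: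
  fixes c :: "('i \<Rightarrow> nat) \<Rightarrow> real"
  assumes "finite I" "finite B" "inj_on (\<lambda>\<beta>. restrict \<beta> I) B" "b \<in> B" "c b \<noteq> 0"
  shows "\<exists>w. (\<Sum>\<beta>\<in>B. c \<beta> * (\<Prod>i\<in>I. w i ^ \<beta> i)) \<noteq> 0"
  using assms
proof (induction I arbitrary: B rule: finite_induct)
  case empty
  have "\<beta> = b" if "\<beta> \<in> B" for \<beta>
    by (rule inj_onD[OF empty.prems(2) _ that empty.prems(3)]) simp
  then have "B = {b}" using empty.prems(3) by blast
  then show ?case using empty.prems(4) by simp
next
  case (insert j I)
  define B' where "B' = {\<beta> \<in> B. \<beta> j = b j}"
  have "inj_on (\<lambda>\<beta>. restrict \<beta> I) B'"
  proof (rule inj_onI)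
    fix \<alpha> \<beta> assume *: "\<alpha> \<in> B'" "\<beta> \<in> B'" "restrict \<alpha> I = restrict \<beta> I"
    then have "\<alpha> i = \<beta> i" if "i \<in> I" for i using that by (metis restrict_apply')
    then have "restrict \<alpha> (insert j I) = restrict \<beta> (insert j I)"
      using * by (auto simp: B'_def restrict_def)
    with * insert.prems(2) show "\<alpha> = \<beta>" unfolding inj_on_def B'_def by blast
  qed
  from insert.IH[OF _ this] insert.prems obtain w where w: "(\<Sum>\<beta>\<in>B'. c \<beta> * (\<Prod>i\<in>I. w i ^ \<beta> i)) \<noteq> 0"
    by (auto simp: B'_def)
  define q where "q = (\<Sum>\<beta>\<in>B. monom (c \<beta> * (\<Prod>i\<in>I. w i ^ \<beta> i)) (\<beta> j))"
  have "coeff q (b j) = (\<Sum>\<beta>\<in>B'. c \<beta> * (\<Prod>i\<in>I. w i ^ \<beta> i))"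
    unfolding q_def B'_def coeff_sum using insert.prems(1)
    by (auto simp: sum.If_cases Int_def intro!: sum.cong)
  with w have "q \<noteq> 0" by auto
  then obtain y where "poly q y \<noteq> 0" using poly_all_0_iff_0 by blast
  moreover have "poly q y = (\<Sum>\<beta>\<in>B. c \<beta> * (\<Prod>i\<in>insert j I. (w(j := y)) i ^ \<beta> i))"
  proof -
    have "(\<Prod>i\<in>I. (w(j := y)) i ^ \<beta> i) = (\<Prod>i\<in>I. w i ^ \<beta> i)" for \<beta>
      using insert.hyps by (intro prod.cong) auto
    then show ?thesis using insert.hyps by (simp add: q_def poly_sum poly_monom mult_ac)
  qed
  ultimately show ?case by (intro exI[of _ "w(j := y)"]) simp
qed

lemma continuous_on_mpeval: "continuous_on T (mpeval p)"
  unfolding mpeval_def by (intro continuous_intros)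

text \<open>The direction \<open>w\<close> is one in which the leading form of \<open>f\<close> at
  \<open>x0\<close>, of degree \<open>K\<close>, does not vanish. Since the order is
  \<open>K\<close> on all of \<open>S\<close>, the factor \<open>t ^ K\<close> splits off at every
  point of \<open>S\<close>, and the cofactor is nonzero near \<open>(x0, 0)\<close> by
  continuity.\<close>

lemma order_invariant_direction:
  fixes f :: "'m::finite mpoly"
  assumes "f \<noteq> 0" "order_invariant f S" "x0 \<in> S"
  obtains w :: "'m \<Rightarrow> real" and R \<delta> where "0 < R" "0 < \<delta>"
    "\<And>x t. x \<in> S \<Longrightarrow> dist x0 x < \<delta> \<Longrightarrow> t \<noteq> 0 \<Longrightarrow> norm t < R \<Longrightarrow>
       ceval (\<lambda>i. of_real (vec_nth x i) + t * of_real (w i)) f \<noteq> 0"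
proof -
  define d :: "('m \<Rightarrow>\<^sub>0 nat) \<Rightarrow> nat" where "d = (\<lambda>\<beta>. \<Sum>i\<in>UNIV. Poly_Mapping.lookup \<beta> i)"
  obtain K where K: "\<And>v. v \<in> S \<Longrightarrow> mp_ord f v = K"
    using assms(2) unfolding order_invariant_def by blast
  have low: "mpeval (mpdiff \<beta> f) x = 0" if "x \<in> S" "d \<beta> < K" for x \<beta>
    using mp_ord_eqD(1)[OF assms(1) K[OF that(1)]] that(2) by (simp add: d_def)
  obtain \<beta>1 where \<beta>1: "d \<beta>1 = K" "mpeval (mpdiff \<beta>1 f) x0 \<noteq> 0"
    using mp_ord_eqD(2)[OF assms(1) K[OF assms(3)]] by (auto simp: d_def)
  define B where "B = {\<beta> \<in> taylor_support f. d \<beta> = K}"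
  \<comment> \<open>Taylor coefficients at \<open>x0\<close>, indexed by plain functions to fit
    \<open>exists_nonzero_value\<close>.\<close>
  define c :: "('m \<Rightarrow> nat) \<Rightarrow> real" where
    "c = (\<lambda>g. mpeval (mpdiff (Abs_poly_mapping g) f) x0 / (\<Prod>i\<in>UNIV. fact (g i)))"
  have "\<exists>w. (\<Sum>\<beta>\<in>Poly_Mapping.lookup ` B. c \<beta> * (\<Prod>i\<in>UNIV. w i ^ \<beta> i)) \<noteq> 0"
  proof (rule exists_nonzero_value)
    have "\<beta>1 \<in> taylor_support f"
    proof (rule ccontr)
      assume "\<beta>1 \<notin> taylor_support f"
      from mpdiff_outside_taylor_support[OF this] \<beta>1(2) show False by (simp add: mpeval_def)
    qed
    then show "Poly_Mapping.lookup \<beta>1 \<in> Poly_Mapping.lookup ` B" using \<beta>1 by (simp add: B_def)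
    show "c (Poly_Mapping.lookup \<beta>1) \<noteq> 0" using \<beta>1(2) by (simp add: c_def lookup_inverse)
  qed (auto simp: B_def finite_taylor_support inj_on_def restrict_def)
  then obtain w where "(\<Sum>\<beta>\<in>Poly_Mapping.lookup ` B. c \<beta> * (\<Prod>i\<in>UNIV. w i ^ \<beta> i)) \<noteq> 0" ..
  then have w: "(\<Sum>\<beta>\<in>B. c (Poly_Mapping.lookup \<beta>) * (\<Prod>i\<in>UNIV. w i ^ Poly_Mapping.lookup \<beta> i)) \<noteq> 0"
    by (subst (asm) sum.reindex) (auto simp: inj_on_def lookup_inject)
  define W :: "('m \<Rightarrow>\<^sub>0 nat) \<Rightarrow> complex" where
    "W = (\<lambda>\<beta>. \<Prod>i\<in>UNIV. of_real (w i) ^ Poly_Mapping.lookup \<beta> i / fact (Poly_Mapping.lookup \<beta> i))"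
  \<comment> \<open>The Taylor polynomial along \<open>w\<close> without its terms of degree below
    \<open>K\<close>, divided by \<open>t ^ K\<close>. It is continuous in both arguments, and at
    \<open>(x0, 0)\<close> it is the leading form in direction \<open>w\<close>.\<close>
  define h where "h = (\<lambda>y. \<Sum>\<beta>\<in>{\<beta> \<in> taylor_support f. K \<le> d \<beta>}.
     of_real (mpeval (mpdiff \<beta> f) (fst y)) * W \<beta> * snd y ^ (d \<beta> - K))"
  have "h (x0, 0) = (\<Sum>\<beta>\<in>B. of_real (mpeval (mpdiff \<beta> f) x0) * W \<beta>)"
    unfolding h_def B_def
    by (intro sum.mono_neutral_cong_right) (auto simp: finite_taylor_support)
  also have "\<dots> = of_real (\<Sum>\<beta>\<in>B. c (Poly_Mapping.lookup \<beta>) * (\<Prod>i\<in>UNIV. w i ^ Poly_Mapping.lookup \<beta> i))"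
    by (simp add: c_def W_def lookup_inverse prod_dividef)
  finally have h0: "h (x0, 0) \<noteq> 0" using w by (metis of_real_eq_0_iff)
  have "continuous_on UNIV h"
    unfolding h_def by (intro continuous_intros continuous_on_compose2[OF continuous_on_mpeval]) auto
  then have "isCont h (x0, 0)"
    using continuous_on_eq_continuous_at[OF open_UNIV] by blast
  then obtain e where e: "e > 0" "\<And>y. dist (x0, 0) y < e \<Longrightarrow> h y \<noteq> 0"
    using continuous_at_avoid[of "(x0, 0)" h 0] h0 by blast
  \<comment> \<open>Order-invariance enters here: for \<open>x\<close> in \<open>S\<close> the terms
    of degree below \<open>K\<close> vanish.\<close>
  have taylor: "ceval (\<lambda>i. of_real (vec_nth x i) + t * of_real (w i)) f = t ^ K * h (x, t)" if "x \<in> S" for x t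
  proof -
    have "(\<Prod>i\<in>UNIV. (t * of_real (w i)) ^ Poly_Mapping.lookup \<beta> i / fact (Poly_Mapping.lookup \<beta> i)) = t ^ d \<beta> * W \<beta>" for \<beta>
      by (simp add: power_mult_distrib prod.distrib prod_dividef W_def d_def power_sum)
    then have "ceval (\<lambda>i. of_real (vec_nth x i) + t * of_real (w i)) f =
        (\<Sum>\<beta>\<in>taylor_support f. of_real (mpeval (mpdiff \<beta> f) x) * (t ^ d \<beta> * W \<beta>))"
      by (simp add: ceval_taylor of_real_mpeval)
    also have "\<dots> = (\<Sum>\<beta>\<in>{\<beta> \<in> taylor_support f. K \<le> d \<beta>}. of_real (mpeval (mpdiff \<beta> f) x) * (t ^ d \<beta> * W \<beta>))"
      using low[OF that] by (intro sum.mono_neutral_right) (auto simp: finite_taylor_support)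
    also have "\<dots> = t ^ K * h (x, t)"
      unfolding h_def sum_distrib_left by (intro sum.cong refl) (auto simp: mult_ac power_add[symmetric])
    finally show ?thesis .
  qed
  show ?thesis
  proof (rule that[of "e / 2" "e / 2" w])
    fix x :: "real^'m" and t :: complex
    assume *: "x \<in> S" "dist x0 x < e / 2" "t \<noteq> 0" "norm t < e / 2"
    have "dist (x0, 0) (x, t) \<le> dist x0 x + dist 0 t"
      by (simp add: dist_Pair_Pair sqrt_sum_squares_le_sum)
    with * have "h (x, t) \<noteq> 0" by (intro e) auto
    with * show "ceval (\<lambda>i. of_real (vec_nth x i) + t * of_real (w i)) f \<noteq> 0" by (simp add: taylor)
  qed (use e in auto)
qed

section \<open>Bezout identity for the Sylvester resultant\<close>

text \<open>The rows of the Sylvester matrix are the coefficients of shifts of \<open>p\<close> and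
  \<open>q\<close>. A row of the adjugate combines them into the determinant times one monomial. The
  exponent \<open>j\<close> is left free because the two affine charts need different
  monomials.\<close>

lemma sylvester_bezout:
  fixes p q :: "'a::comm_ring_1 poly"
  assumes "0 < m" "0 < n" "degree p \<le> m" "degree q \<le> n" "j < m + n"
  obtains u v where "degree u \<le> n - 1" "degree v \<le> m - 1"
    "monom (resultant_sub m n p q) j = u * p + v * q"
proof -
  define M where "M = sylvester_mat_sub m n p q"
  \<comment> \<open>Columns run from degree \<open>m + n - 1\<close> down to 0, so \<open>k\<close>
    is the column of the monomial of degree \<open>j\<close>.\<close>
  define k where "k = m + n - 1 - j"
  define a where "a = (\<lambda>i. adj_mat M $$ (k, i))"
  define s where "s = (\<lambda>i. if i < n then monom 1 (n - 1 - i) * p else monom 1 (m + n - 1 - i) * q)"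
  have k: "k < m + n" "j = m + n - 1 - k" using assms by (auto simp: k_def)
  have carr: "M \<in> carrier_mat (m + n) (m + n)" by (simp add: M_def sylvester_mat_sub_carrier)
  note adj = adj_mat[OF carr]
  have Ms: "M $$ (i, l) = coeff (s i) (m + n - 1 - l)" if "i < m + n" "l < m + n" for i l
    using that assms by (auto simp: M_def sylvester_mat_sub_index s_def coeff_monom_mult
        intro!: arg_cong[of _ _ "coeff p"] arg_cong[of _ _ "coeff q"] coeff_eq_0 coeff_eq_0[symmetric])
  define u where "u = (\<Sum>i<n. monom (a i) (n - 1 - i))"
  define v where "v = (\<Sum>i\<in>{n..<m + n}. monom (a i) (m + n - 1 - i))"
  have uv: "u * p + v * q = (\<Sum>i<m + n. smult (a i) (s i))"
  proof -
    have "(\<Sum>i<m + n. smult (a i) (s i)) = (\<Sum>i<n. smult (a i) (s i)) + (\<Sum>i\<in>{n..<m + n}. smult (a i) (s i))"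
      using sum.atLeastLessThan_concat[of 0 n "m + n" "\<lambda>i. smult (a i) (s i)"] by (simp add: lessThan_atLeast0)
    moreover have "smult c (monom 1 e * r) = monom c e * r" for c :: 'a and e r
      by (metis mult.right_neutral mult_smult_left smult_monom)
    ultimately show ?thesis
      by (simp add: u_def v_def s_def sum_distrib_right)
  qed
  have "monom (resultant_sub m n p q) j = u * p + v * q"
  proof (rule poly_eqI)
    fix e
    show "coeff (monom (resultant_sub m n p q) j) e = coeff (u * p + v * q) e"
    proof (cases "e < m + n")
      case True
      define l where "l = m + n - 1 - e"
      have l: "l < m + n" "e = m + n - 1 - l" using True by (auto simp: l_def)
      have "coeff (u * p + v * q) e = (\<Sum>i<m + n. a i * M $$ (i, l))"
        unfolding uv using l by (simp add: coeff_sum Ms)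
      also have "\<dots> = (adj_mat M * M) $$ (k, l)"
        using adj(1) carr k l by (simp add: a_def scalar_prod_def lessThan_atLeast0)
      also have "\<dots> = (if k = l then Determinant.det M else 0)"
        using adj(3) k l by simp
      finally show ?thesis
        using k l by (auto simp: resultant_sub_def M_def)
    next
      case False
      have "coeff (s i) e = 0" if "i < m + n" for i
        using False assms that by (auto simp: s_def coeff_monom_mult intro!: coeff_eq_0)
      then have "coeff (u * p + v * q) e = 0" unfolding uv by (simp add: coeff_sum)
      with False assms show ?thesis by simp
    qed
  qed
  moreover have "degree u \<le> n - 1"
    unfolding u_def by (intro degree_sum_le) (auto intro: order_trans[OF degree_monom_le])
  moreover have "degree v \<le> m - 1"
    unfolding v_def by (intro degree_sum_le) (auto intro: order_trans[OF degree_monom_le])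
  ultimately show ?thesis using that by blast
qed

section \<open>Affine charts of the projective line\<close>

text \<open>The two affine charts of the projective line: \<open>s = False\<close> is the chart \<open>z \<mapsto> (z : 1)\<close>,
  \<open>s = True\<close> is the chart \<open>z \<mapsto> (1 : z)\<close> around the point at infinity.\<close>

definition chart_pt :: "bool \<Rightarrow> real \<Rightarrow> real \<times> real" where
  "chart_pt s z = (if s then (1, z) else (z, 1))"

text \<open>The reversal for \<open>s = True\<close> is relative to the formal degree
  \<open>d\<close>: a degree below \<open>d\<close>, that is a root at infinity, becomes a root at 0
  of the right multiplicity.\<close>

definition chart_poly :: "bool \<Rightarrow> nat \<Rightarrow> 'a::comm_monoid_add poly \<Rightarrow> 'a poly" where
  "chart_poly s d p = (\<Sum>k\<le>d. monom (coeff p (if s then d - k else k)) k)"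

lemma coeff_chart_poly:
  "coeff (chart_poly s d p) k = (if k \<le> d then coeff p (if s then d - k else k) else 0)"
  by (auto simp: chart_poly_def coeff_sum)

lemma degree_chart_poly: "degree (chart_poly s d p) \<le> d"
  by (rule degree_le) (simp add: coeff_chart_poly)

lemma chart_poly_False: "degree p \<le> d \<Longrightarrow> chart_poly False d p = p"
  by (rule poly_eqI) (auto simp: coeff_chart_poly coeff_eq_0)

lemma chart_poly_add: "chart_poly s d (p + q) = chart_poly s d p + chart_poly s d q"
  by (rule poly_eqI) (auto simp: coeff_chart_poly)

lemma chart_poly_True_eq_reflect:
  fixes p :: "'a::comm_semiring_1 poly"
  assumes "degree p \<le> d"
  shows "chart_poly True d p = monom 1 (d - degree p) * reflect_poly p"
  using assms
  by (intro poly_eqI) (auto simp: coeff_chart_poly coeff_monom_mult coeff_reflect_poly coeff_eq_0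
      intro!: arg_cong[of _ _ "coeff p"])

lemma chart_poly_mult:
  fixes p q :: "'a::idom poly"
  assumes "degree p \<le> d" "degree q \<le> e"
  shows "chart_poly s (d + e) (p * q) = chart_poly s d p * chart_poly s e q"
proof (cases "s \<and> p \<noteq> 0 \<and> q \<noteq> 0")
  case True
  then have "degree (p * q) = degree p + degree q" by (simp add: degree_mult_eq)
  with True assms show ?thesis
    by (simp add: chart_poly_True_eq_reflect reflect_poly_mult mult_monom mult_ac flip: mult.assoc)
next
  case False
  then consider "\<not> s" | "p = 0 \<or> q = 0" by blast
  then show ?thesis
  proof cases
    case 1
    have "degree (p * q) \<le> d + e" using degree_mult_le[of p q] assms by simp
    with 1 assms show ?thesis by (simp add: chart_poly_False)
  next
    case 2
    then show ?thesis by (auto simp: chart_poly_def)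
  qed
qed

text \<open>This fixes the monomial for the Bezout identity: degree 0 in the finite chart and top
  degree in the chart at infinity both become constants.\<close>

lemma chart_poly_monom: "chart_poly s d (monom c (if s then d else 0)) = [:c:]"
  by (rule poly_eqI) (auto simp: coeff_chart_poly coeff_pCons split: nat.split)

lemma bf_eval_hform: "bf_eval (hform d f) u v = (\<Sum>k\<le>d. coeff f k * u ^ k * v ^ (d - k))"
  unfolding bf_eval_def hform_def
  by (simp add: poly_sum poly_monom poly_power mult_ac flip: pCons_one)

lemma bf_eval_hform_scale: "bf_eval (hform d f) (t * u) (t * v) = t ^ d * bf_eval (hform d f) u v"
proof -
  have "coeff f k * (t * u) ^ k * (t * v) ^ (d - k) = t ^ d * (coeff f k * u ^ k * v ^ (d - k))" if "k \<le> d" for k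
  proof -
    have "t ^ d = t ^ k * t ^ (d - k)" using that by (simp add: power_add[symmetric])
    then show ?thesis by (simp add: power_mult_distrib)
  qed
  then show ?thesis unfolding bf_eval_hform sum_distrib_left by (intro sum.cong) auto
qed

lemma bf_eval_chart:
  "bf_eval (hform d f) (fst (chart_pt s z)) (snd (chart_pt s z)) = poly (chart_poly s d f) z"
proof (cases s)
  case True
  have "(\<Sum>k\<le>d. coeff f k * z ^ (d - k)) = (\<Sum>k\<le>d. coeff f (d - k) * z ^ k)"
    by (rule sum.reindex_bij_witness[of _ "\<lambda>k. d - k" "\<lambda>k. d - k"]) auto
  with True show ?thesis
    by (simp add: bf_eval_hform chart_pt_def chart_poly_def poly_sum poly_monom)
qed (simp add: bf_eval_hform chart_pt_def chart_poly_def poly_sum poly_monom)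

text \<open>Passes from the chart \<open>s\<close> back to binary forms of degree \<open>d\<close>;
  the variable set to 1 in that chart takes up the missing degree.\<close>

definition homogenize :: "bool \<Rightarrow> nat \<Rightarrow> real poly \<Rightarrow> real poly poly" where
  "homogenize s d g = (\<Sum>k\<le>d. if s then monom (monom (coeff g k) k) (d - k) else monom (monom (coeff g k) (d - k)) k)"

lemma coeff_homogenize:
  "coeff (coeff (homogenize s d g) i) j = (if i + j = d then coeff g (if s then j else i) else 0)"
proof (cases s)
  case True
  have "coeff (coeff (homogenize s d g) i) j = (\<Sum>k\<le>d. if k = j \<and> d - k = i then coeff g k else 0)"
    unfolding homogenize_def coeff_sum using True by (intro sum.cong) auto
  also have "\<dots> = (\<Sum>k\<le>d. if k = j then (if i + j = d then coeff g j else 0) else 0)"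
    by (intro sum.cong) auto
  finally show ?thesis using True by auto
next
  case False
  have "coeff (coeff (homogenize s d g) i) j = (\<Sum>k\<le>d. if k = i \<and> d - k = j then coeff g k else 0)"
    unfolding homogenize_def coeff_sum using False by (intro sum.cong) auto
  also have "\<dots> = (\<Sum>k\<le>d. if k = i then (if i + j = d then coeff g i else 0) else 0)"
    by (intro sum.cong) auto
  finally show ?thesis using False by auto
qed

lemma hform_eq_homogenize: "hform d f = homogenize s d (chart_poly s d f)"
proof -
  have "hform d f = homogenize False d f" by (simp add: hform_def homogenize_def)
  then show ?thesis by (intro poly_eqI) (auto simp: coeff_homogenize coeff_chart_poly)
qed

text \<open>The sign makes the form restrict to \<open>[:-z, 1:]\<close> in both charts.\<close>

definition chart_lin :: "bool \<Rightarrow> real \<Rightarrow> real poly poly" where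
  "chart_lin s z = (if s then - lin_form 1 z else lin_form z 1)"

lemma homogenize_linear_factor:
  assumes "degree g \<le> d"
  shows "homogenize s (Suc d) ([:-z, 1:] * g) = chart_lin s z * homogenize s d g"
proof (intro poly_eqI)
  fix i j
  show "coeff (coeff (homogenize s (Suc d) ([:-z, 1:] * g)) i) j = coeff (coeff (chart_lin s z * homogenize s d g) i) j"
    using assms coeff_eq_0[of g]
    by (cases i; cases j) (auto simp: chart_lin_def lin_form_def coeff_homogenize coeff_pCons split: nat.split)
qed

lemma homogenize_linear_factor_power:
  assumes "degree g \<le> d"
  shows "homogenize s (n + d) ([:-z, 1:] ^ n * g) = chart_lin s z ^ n * homogenize s d g"
proof (induction n)
  case (Suc n)
  have "degree ([:-z, 1:] ^ n * g) \<le> n + d"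
    using assms degree_mult_le[of "[:-z, 1:] ^ n" g] degree_linear_power[of "-z" n] by linarith
  from homogenize_linear_factor[OF this, of s z] Suc show ?case
    by (simp only: power_Suc mult.assoc add_Suc)
qed simp

text \<open>Setting one variable to 1 is a ring homomorphism \<open>\<phi>\<close> that carries a
  factorization of the form to one of the chart polynomial. Conversely, homogenizing the latter
  gives a factorization of the form.\<close>

lemma lin_form_dvd_iff:
  assumes "chart_poly s d f \<noteq> 0"
  shows "chart_lin s z ^ n dvd hform d f \<longleftrightarrow> n \<le> order z (chart_poly s d f)"
proof
  define \<phi> :: "real poly poly \<Rightarrow> real poly" where
    "\<phi> = (if s then (\<lambda>g. poly g 1) else map_poly (\<lambda>c. poly c 1))"
  interpret h: comm_ring_hom "\<lambda>c. poly c (1::real)" by unfold_locales auto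
  interpret mh: map_poly_comm_ring_hom "\<lambda>c. poly c (1::real)" ..
  have mult: "\<phi> (a * b) = \<phi> a * \<phi> b" for a b by (simp add: \<phi>_def mh.hom_mult)
  have one: "\<phi> 1 = 1" by (simp add: \<phi>_def)
  have power: "\<phi> (a ^ n) = \<phi> a ^ n" for a n by (induction n) (auto simp: mult one)
  have lin: "\<phi> (chart_lin s z) = [:-z, 1:]"
    by (auto simp: \<phi>_def chart_lin_def lin_form_def map_poly_pCons)
  have form: "\<phi> (hform d f) = chart_poly s d f"
  proof (cases s)
    case True
    have "(\<Sum>k\<le>d. monom (coeff f k) (d - k)) = (\<Sum>k\<le>d. monom (coeff f (d - k)) k)"
      by (rule sum.reindex_bij_witness[of _ "\<lambda>k. d - k" "\<lambda>k. d - k"]) auto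
    with True show ?thesis
      by (simp add: \<phi>_def hform_def chart_poly_def poly_sum poly_monom)
  next
    case False
    then show ?thesis
      by (auto simp: \<phi>_def hform_def chart_poly_def mh.hom_sum map_poly_monom poly_monom)
  qed
  {
    assume "chart_lin s z ^ n dvd hform d f"
    then obtain g where "hform d f = chart_lin s z ^ n * g" by (elim dvdE)
    then have "chart_poly s d f = [:-z, 1:] ^ n * \<phi> g" by (metis form lin mult power)
    then have "[:-z, 1:] ^ n dvd chart_poly s d f" by simp
    with assms show "n \<le> order z (chart_poly s d f)" by (simp add: order_divides)
  }
  assume "n \<le> order z (chart_poly s d f)"
  then have "[:-z, 1:] ^ n dvd chart_poly s d f" by (simp add: order_divides)
  then obtain g where g: "chart_poly s d f = [:-z, 1:] ^ n * g" by (elim dvdE)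
  then have "g \<noteq> 0" using assms by auto
  then have "degree (chart_poly s d f) = n + degree g"
    unfolding g by (subst degree_mult_eq) (auto simp: degree_linear_power)
  with degree_chart_poly[of s d f] have le: "n \<le> d" "degree g \<le> d - n" by auto
  have "hform d f = chart_lin s z ^ n * homogenize s (d - n) g"
    using homogenize_linear_factor_power[OF le(2), of s n z] le(1) hform_eq_homogenize[of d f s] g by simp
  then show "chart_lin s z ^ n dvd hform d f" by simp
qed

lemma chart_poly_eq_0_iff:
  assumes "degree f \<le> d"
  shows "chart_poly s d f = 0 \<longleftrightarrow> f = 0"
proof
  assume 0: "chart_poly s d f = 0"
  show "f = 0"
  proof (rule poly_eqI)
    fix k
    show "coeff f k = coeff 0 k"
      using assms coeff_eq_0[of f k] arg_cong[OF 0, of "\<lambda>p. coeff p (if s then d - k else k)"]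
      by (cases "k \<le> d") (auto simp: coeff_chart_poly split: if_splits)
  qed
qed (simp add: chart_poly_def)

text \<open>Changing the representative multiplies the linear form by a nonzero constant, a unit, so
  the multiplicity can be read off in the chart.\<close>

lemma bf_mult_eq_order:
  assumes "chart_poly s d f \<noteq> 0" "(u, v) \<noteq> (0, 0)" "proj_class (chart_pt s z) = proj_class (u, v)"
  shows "bf_mult (hform d f) u v = order z (chart_poly s d f)"
proof -
  have "(u, v) \<in> proj_class (u, v)" unfolding proj_class_def by force
  then have "(u, v) \<in> proj_class (chart_pt s z)" using assms(3) by simp
  then obtain t where t: "t \<noteq> 0" "u = t * fst (chart_pt s z)" "v = t * snd (chart_pt s z)"
    unfolding proj_class_def by blast
  define c where "c = (if s then [:[:-t:]:] else [:[:t:]:])"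
  have c: "lin_form u v = c * chart_lin s z"
    using t by (auto simp: c_def lin_form_def chart_lin_def chart_pt_def)
  have "c * (if s then [:[:-1/t:]:] else [:[:1/t:]:]) = 1"
    using t(1) by (auto simp: c_def one_pCons)
  then have "is_unit c" by (metis dvd_triv_left)
  then have "lin_form u v ^ n dvd hform d f \<longleftrightarrow> chart_lin s z ^ n dvd hform d f" for n
    unfolding c power_mult_distrib by (simp add: mult_unit_dvd_iff' is_unit_power_iff)
  then show ?thesis
    unfolding bf_mult_def lin_form_dvd_iff[OF assms(1)] by (auto intro!: Greatest_equality)
qed

section \<open>Topology of the projective line\<close>

lemma openin_RP1_top:
  "openin RP1_top U \<longleftrightarrow> U \<subseteq> RP1 \<and> openin (top_of_set (- {(0, 0)})) {z \<in> - {(0, 0)}. proj_class z \<in> U}"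
proof -
  let ?X = "top_of_set (- {(0::real, 0::real)})"
  let ?pre = "\<lambda>U. {z \<in> - {(0, 0)}. proj_class z \<in> U}"
  have "istopology (\<lambda>U. U \<subseteq> RP1 \<and> openin ?X (?pre U))"
    unfolding istopology_def
  proof (intro conjI allI impI)
    fix U V assume *: "U \<subseteq> RP1 \<and> openin ?X (?pre U)" "V \<subseteq> RP1 \<and> openin ?X (?pre V)"
    have "?pre (U \<inter> V) = ?pre U \<inter> ?pre V" by auto
    with * show "openin ?X (?pre (U \<inter> V))" by (simp add: openin_Int)
    from * show "U \<inter> V \<subseteq> RP1" by auto
  next
    fix \<K> assume *: "\<forall>K\<in>\<K>. K \<subseteq> RP1 \<and> openin ?X (?pre K)"
    have "?pre (\<Union>\<K>) = \<Union>(?pre ` \<K>)" by auto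
    moreover have "openin ?X (\<Union>(?pre ` \<K>))"
      by (rule openin_Union) (use * in blast)
    ultimately show "openin ?X (?pre (\<Union>\<K>))" by simp
    from * show "\<Union>\<K> \<subseteq> RP1" by auto
  qed
  then show ?thesis unfolding RP1_top_def by (simp add: topology_inverse')
qed

lemma proj_class_chart_pt_eq_iff:
  "proj_class p = proj_class (chart_pt s z) \<longleftrightarrow>
     (if s then fst p \<noteq> 0 \<and> snd p = z * fst p else snd p \<noteq> 0 \<and> fst p = z * snd p)"
  (is "_ \<longleftrightarrow> ?R")
proof
  assume "proj_class p = proj_class (chart_pt s z)"
  moreover have "p \<in> proj_class p" unfolding proj_class_def by (cases p) force
  ultimately have "p \<in> proj_class (chart_pt s z)" by simp
  then show ?R by (auto simp: proj_class_def chart_pt_def split: if_splits)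
next
  assume R: ?R
  define c where "c = (if s then fst p else snd p)"
  have c: "c \<noteq> 0" "p = (c * fst (chart_pt s z), c * snd (chart_pt s z))"
    using R by (auto simp: c_def chart_pt_def prod_eq_iff split: if_splits)
  show "proj_class p = proj_class (chart_pt s z)"
  proof (intro Set.set_eqI iffI)
    fix y assume "y \<in> proj_class p"
    then obtain t where "t \<noteq> 0" "y = (t * fst p, t * snd p)" unfolding proj_class_def by blast
    with c show "y \<in> proj_class (chart_pt s z)"
      unfolding proj_class_def by (auto intro!: exI[of _ "t * c"])
  next
    fix y assume "y \<in> proj_class (chart_pt s z)"
    then obtain t where t: "t \<noteq> 0" "y = (t * fst (chart_pt s z), t * snd (chart_pt s z))"
      unfolding proj_class_def by blast
    have "t / c * fst p = t * fst (chart_pt s z)" "t / c * snd p = t * snd (chart_pt s z)"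
      using c by (metis fst_conv nonzero_eq_divide_eq times_divide_eq_left mult.assoc, metis snd_conv nonzero_eq_divide_eq times_divide_eq_left mult.assoc)
    with t c(1) show "y \<in> proj_class p"
      unfolding proj_class_def by (auto intro!: exI[of _ "t / c"])
  qed
qed

lemma chart_pt_nonzero: "chart_pt s z \<noteq> (0, 0)"
  by (simp add: chart_pt_def)

text \<open>The preimage in the punctured plane is cut out by the slope \<open>g\<close>, which is
  continuous on the open set \<open>D\<close> of points lying in the chart.\<close>

lemma openin_RP1_chart: "openin RP1_top {proj_class (chart_pt s z) | z. \<bar>z - z0\<bar> < e}"
proof -
  define D where "D = {p::real \<times> real. if s then fst p \<noteq> 0 else snd p \<noteq> 0}"
  define g where "g = (\<lambda>p::real \<times> real. if s then snd p / fst p else fst p / snd p)"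
  let ?U = "{proj_class (chart_pt s z) | z. \<bar>z - z0\<bar> < e}"
  have D: "open D"
    unfolding D_def by (cases s; simp; intro open_Collect_neq continuous_intros)
  have "continuous_on D (\<lambda>p. \<bar>g p - z0\<bar>)"
    unfolding D_def g_def by (cases s; simp; intro continuous_intros; simp)
  then have "open (D \<inter> (\<lambda>p. \<bar>g p - z0\<bar>) -` {..<e})"
    using D by (rule continuous_open_preimage) auto
  moreover have "{p \<in> - {(0, 0)}. proj_class p \<in> ?U} = D \<inter> (\<lambda>p. \<bar>g p - z0\<bar>) -` {..<e}"
  proof (intro Set.set_eqI iffI)
    fix p assume "p \<in> {p \<in> - {(0, 0)}. proj_class p \<in> ?U}"
    then obtain z where "proj_class p = proj_class (chart_pt s z)" "\<bar>z - z0\<bar> < e" by auto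
    then show "p \<in> D \<inter> (\<lambda>p. \<bar>g p - z0\<bar>) -` {..<e}"
      unfolding proj_class_chart_pt_eq_iff by (auto simp: D_def g_def split: if_splits)
  next
    fix p assume p: "p \<in> D \<inter> (\<lambda>p. \<bar>g p - z0\<bar>) -` {..<e}"
    then have "proj_class p = proj_class (chart_pt s (g p))"
      unfolding proj_class_chart_pt_eq_iff by (auto simp: D_def g_def)
    moreover have "p \<noteq> (0, 0)" using p by (auto simp: D_def split: if_splits)
    ultimately show "p \<in> {p \<in> - {(0, 0)}. proj_class p \<in> ?U}" using p by auto
  qed
  ultimately have "open {p \<in> - {(0, 0)}. proj_class p \<in> ?U}" by simp
  then have "openin (top_of_set (- {(0, 0)})) {p \<in> - {(0, 0)}. proj_class p \<in> ?U}"
    by (intro open_subset) auto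
  moreover have "?U \<subseteq> RP1" unfolding RP1_def using chart_pt_nonzero by blast
  ultimately show ?thesis unfolding openin_RP1_top by blast
qed

text \<open>Openness of chart intervals turns continuity of \<theta> into two facts near
  \<open>x0\<close>: its values stay in one chart, and their coordinate is continuous at
  \<open>x0\<close>.\<close>

lemma proj_chart_nbhd:
  fixes \<theta> :: "'a::metric_space \<Rightarrow> (real \<times> real) set"
  assumes "continuous_map (top_of_set S) RP1_top \<theta>" "x0 \<in> S"
  obtains s \<zeta> \<delta> where "0 < \<delta>" "\<And>x. x \<in> S \<Longrightarrow> dist x0 x < \<delta> \<Longrightarrow> \<theta> x = proj_class (chart_pt s (\<zeta> x))"
    "\<And>e. 0 < e \<Longrightarrow> \<exists>\<eta>>0. \<forall>x\<in>S. dist x0 x < \<eta> \<longrightarrow> \<bar>\<zeta> x0 - \<zeta> x\<bar> < e"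
proof -
  have "\<theta> x0 \<in> topspace RP1_top"
    using assms by (auto simp: continuous_map_def)
  moreover have "topspace RP1_top \<subseteq> RP1"
    using openin_RP1_top openin_topspace by blast
  ultimately obtain p where p: "\<theta> x0 = proj_class p" "p \<noteq> (0, 0)" by (auto simp: RP1_def)
  \<comment> \<open>The chart at infinity is chosen only for the class of (1, 0), whose coordinate
    there is 0.\<close>
  define s where "s \<longleftrightarrow> snd p = 0"
  define z0 where "z0 = (if s then 0 else fst p / snd p)"
  have z0: "\<theta> x0 = proj_class (chart_pt s z0)"
    unfolding p(1) proj_class_chart_pt_eq_iff using p(2) by (cases p) (auto simp: z0_def s_def)
  define \<zeta> where "\<zeta> = (\<lambda>x. THE z. \<theta> x = proj_class (chart_pt s z))"
  have inj: "z = z'" if "proj_class (chart_pt s z) = proj_class (chart_pt s z')" for z z'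
    using that unfolding proj_class_chart_pt_eq_iff by (auto simp: chart_pt_def split: if_splits)
  have \<zeta>: "\<zeta> x = z" if "\<theta> x = proj_class (chart_pt s z)" for x z
    unfolding \<zeta>_def using that by (intro the_equality) (auto dest: inj)
  have near: "\<exists>\<eta>>0. \<forall>x\<in>S. dist x0 x < \<eta> \<longrightarrow> (\<exists>z. \<theta> x = proj_class (chart_pt s z) \<and> \<bar>z - z0\<bar> < e)"
    if "e > 0" for e
  proof -
    have "openin (top_of_set S) {x \<in> S. \<theta> x \<in> {proj_class (chart_pt s z) | z. \<bar>z - z0\<bar> < e}}"
      using openin_continuous_map_preimage[OF assms(1) openin_RP1_chart[of s z0 e]] by simp
    moreover have "x0 \<in> {x \<in> S. \<theta> x \<in> {proj_class (chart_pt s z) | z. \<bar>z - z0\<bar> < e}}"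
      using assms(2) z0 that by auto
    ultimately obtain \<eta> where "\<eta> > 0" "ball x0 \<eta> \<inter> S \<subseteq> {x \<in> S. \<theta> x \<in> {proj_class (chart_pt s z) | z. \<bar>z - z0\<bar> < e}}"
      unfolding openin_contains_ball by blast
    then show ?thesis by (intro exI[of _ \<eta>]) auto
  qed
  have "(0::real) < 1" by simp
  from near[OF this] obtain \<delta> where \<delta>: "\<delta> > 0"
    "\<forall>x\<in>S. dist x0 x < \<delta> \<longrightarrow> (\<exists>z. \<theta> x = proj_class (chart_pt s z) \<and> \<bar>z - z0\<bar> < 1)"
    by (elim exE conjE)
  show ?thesis
  proof (rule that[OF \<delta>(1), of s \<zeta>])
    fix x assume "x \<in> S" "dist x0 x < \<delta>"
    with \<delta>(2) obtain z where "\<theta> x = proj_class (chart_pt s z)" by blast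
    with \<zeta>[OF this] show "\<theta> x = proj_class (chart_pt s (\<zeta> x))" by simp
  next
    fix e :: real assume "0 < e"
    from near[OF this] obtain \<eta> where \<eta>: "\<eta> > 0"
      "\<forall>x\<in>S. dist x0 x < \<eta> \<longrightarrow> (\<exists>z. \<theta> x = proj_class (chart_pt s z) \<and> \<bar>z - z0\<bar> < e)"
      by (elim exE conjE)
    have "\<bar>\<zeta> x0 - \<zeta> x\<bar> < e" if "x \<in> S" "dist x0 x < \<eta>" for x
    proof -
      from \<eta>(2) that obtain z where z: "\<theta> x = proj_class (chart_pt s z)" "\<bar>z - z0\<bar> < e" by blast
      then show ?thesis using \<zeta>[OF z(1)] \<zeta>[OF z0] by simp
    qed
    with \<eta>(1) show "\<exists>\<eta>>0. \<forall>x\<in>S. dist x0 x < \<eta> \<longrightarrow> \<bar>\<zeta> x0 - \<zeta> x\<bar> < e" by blast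
  qed
qed

text \<open>By homogeneity, rescaling a representative by \<open>t\<close> multiplies the value by
  \<open>t ^ d\<close>, so one representative decides for the whole class.\<close>

lemma zero_on_class_iff:
  assumes "c = proj_class (chart_pt s z)"
  shows "(\<forall>(u, v)\<in>c. bf_eval (hform d f) u v = 0) \<longleftrightarrow> poly (chart_poly s d f) z = 0"
    and "(\<forall>(u, v)\<in>c. bf_eval (hform d f) u v \<noteq> 0) \<longleftrightarrow> poly (chart_poly s d f) z \<noteq> 0"
proof -
  have *: "bf_eval (hform d f) u v = 0 \<longleftrightarrow> poly (chart_poly s d f) z = 0" if "(u, v) \<in> c" for u v
  proof -
    from that have "(u, v) \<in> proj_class (chart_pt s z)" by (simp add: assms)
    then obtain t where t: "t \<noteq> 0" "u = t * fst (chart_pt s z)" "v = t * snd (chart_pt s z)"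
      unfolding proj_class_def by blast
    have "bf_eval (hform d f) u v = t ^ d * poly (chart_poly s d f) z"
      by (simp only: t bf_eval_hform_scale bf_eval_chart)
    with t(1) show ?thesis by simp
  qed
  obtain u0 v0 where m: "(u0, v0) \<in> c"
  proof
    show "(1 * fst (chart_pt s z), 1 * snd (chart_pt s z)) \<in> c"
      unfolding assms proj_class_def by (intro CollectI exI[of _ 1]) simp
  qed
  have "(\<forall>(u, v)\<in>c. bf_eval (hform d f) u v = 0) \<longleftrightarrow> (\<forall>(u, v)\<in>c. poly (chart_poly s d f) z = 0)"
    by (rule ball_cong) (auto simp: *)
  with m show "(\<forall>(u, v)\<in>c. bf_eval (hform d f) u v = 0) \<longleftrightarrow> poly (chart_poly s d f) z = 0"
    by auto
  have "(\<forall>(u, v)\<in>c. bf_eval (hform d f) u v \<noteq> 0) \<longleftrightarrow> (\<forall>(u, v)\<in>c. poly (chart_poly s d f) z \<noteq> 0)"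
    by (rule ball_cong) (auto simp: *)
  with m show "(\<forall>(u, v)\<in>c. bf_eval (hform d f) u v \<noteq> 0) \<longleftrightarrow> poly (chart_poly s d f) z \<noteq> 0"
    by auto
qed

section \<open>Restriction to complex lines\<close>

lemma coeff_Eval: "coeff (Eval x P) k = mpeval (coeff P k) x"
  unfolding Eval_def by (subst coeff_map_poly) (auto simp: mpeval_def)

lemma degree_Eval: "degree (Eval x P) \<le> degree P"
  by (rule degree_le) (simp add: coeff_Eval coeff_eq_0 mpeval_def)

definition line_pt :: "('m::finite \<Rightarrow> real) \<Rightarrow> (real^'m) \<times> complex \<Rightarrow> 'm \<Rightarrow> complex" where
  "line_pt w y = (\<lambda>i. of_real (vec_nth (fst y) i) + snd y * of_real (w i))"

lemma hol_param_ceval_line_pt: "hol_param (\<lambda>y. ceval (line_pt w y) c)"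
  unfolding ceval_def line_pt_def
  by (intro hol_param_sum hol_param_mult hol_param_const hol_param_prod hol_param_power hol_param_add
      hol_param_snd hol_param_fst[of "\<lambda>x. of_real (vec_nth x _)"] continuous_intros)

definition line_poly :: "bool \<Rightarrow> ('m::finite \<Rightarrow> real) \<Rightarrow> nat \<Rightarrow> 'm mpoly poly \<Rightarrow> (real^'m) \<times> complex \<Rightarrow> complex poly" where
  "line_poly s w d P y = chart_poly s d (map_poly (ceval (line_pt w y)) P)"

lemma hol_param_coeff_line_poly: "hol_param (\<lambda>y. coeff (line_poly s w d P y) k)"
  unfolding line_poly_def coeff_chart_poly coeff_map_poly[of "ceval z" for z, OF ceval_zero]
  by (cases "k \<le> d") (simp_all add: hol_param_ceval_line_pt hol_param_const)

lemma poly_family_line_poly: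
  assumes "d \<le> e" shows "poly_family e (line_poly s w d P)"
  using hol_param_coeff_line_poly[of s w d P] degree_chart_poly[of s d] assms
  unfolding poly_family_def hol_param_def line_poly_def by (meson order_trans)

lemma line_poly_real:
  "line_poly s w d P (x, 0) = map_poly of_real (chart_poly s d (Eval x P))"
  unfolding line_poly_def
  by (rule poly_eqI) (simp add: coeff_chart_poly coeff_map_poly coeff_Eval of_real_mpeval line_pt_def)

lemma order_map_poly_of_real:
  "order (complex_of_real x) (map_poly of_real f) = order x f"
proof -
  interpret map_poly_inj_idom_divide_hom "of_real :: real \<Rightarrow> complex" ..
  show ?thesis by (rule order_hom)
qed

lemma poly_map_poly_of_real:
  "poly (map_poly of_real f) (complex_of_real x) = of_real (poly f x)"
  by (rule of_real_hom.poly_map_poly)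

text \<open>One cofactor \<open>V\<close> over the polynomial ring serves all lines and points,
  since evaluation along a line is a ring homomorphism and commutes with the identity.\<close>

lemma line_poly_bezout:
  fixes P Q :: "'m::finite mpoly poly"
  assumes "0 < degree P" "0 < degree Q"
  obtains V where "\<And>w y z. poly (line_poly s w (degree P) P y) z = 0 \<Longrightarrow>
    poly (line_poly s w (degree P - 1) V y) z * poly (line_poly s w (degree Q) Q y) z =
      ceval (line_pt w y) (resultant_sub (degree P) (degree Q) P Q)"
proof -
  define p q where "p = degree P" and "q = degree Q"
  define F where "F = resultant_sub p q P Q"
  obtain U V where UV: "degree U \<le> q - 1" "degree V \<le> p - 1"
    "monom F (if s then p + q - 1 else 0) = U * P + V * Q"
    unfolding F_def by (rule sylvester_bezout[of p q P Q "if s then p + q - 1 else 0"])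
      (use assms in \<open>auto simp: p_def q_def\<close>)
  show ?thesis
  proof (rule that[of V])
    fix w y z
    assume 0: "poly (line_poly s w (degree P) P y) z = 0"
    let ?h = "map_poly (ceval (line_pt w y))"
    interpret h: comm_ring_hom "ceval (line_pt w y)" by (rule comm_ring_hom_ceval)
    interpret mh: map_poly_comm_ring_hom "ceval (line_pt w y)" ..
    have deg: "degree (?h R) \<le> degree R" for R by (rule degree_map_poly_le)
    have "?h (monom F (if s then p + q - 1 else 0)) = ?h U * ?h P + ?h V * ?h Q"
      unfolding UV(3) by (simp only: mh.hom_add mh.hom_mult)
    \<comment> \<open>Both products are read with formal degree \<open>p + q - 1\<close>, split as
      \<open>q - 1 + p\<close> and as \<open>p - 1 + q\<close>, so that
      \<open>chart_poly_mult\<close> applies to each.\<close>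
    then have "chart_poly s (p + q - 1) (monom (ceval (line_pt w y) F) (if s then p + q - 1 else 0)) =
        chart_poly s (q - 1 + p) (?h U * ?h P) + chart_poly s (p - 1 + q) (?h V * ?h Q)"
      using assms by (simp add: map_poly_monom chart_poly_add p_def q_def add.commute)
    also have "\<dots> = chart_poly s (q - 1) (?h U) * chart_poly s p (?h P) + chart_poly s (p - 1) (?h V) * chart_poly s q (?h Q)"
      using deg[of U] deg[of V] deg[of P] deg[of Q] UV(1,2)
      by (subst (1 2) chart_poly_mult) (auto simp: p_def q_def)
    finally have "[:ceval (line_pt w y) F:] =
        chart_poly s (q - 1) (?h U) * chart_poly s p (?h P) + chart_poly s (p - 1) (?h V) * chart_poly s q (?h Q)"
      by (simp only: chart_poly_monom)
    from arg_cong[OF this, of "\<lambda>r. poly r z"] 0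
    show "poly (line_poly s w (degree P - 1) V y) z * poly (line_poly s w (degree Q) Q y) z =
        ceval (line_pt w y) (resultant_sub (degree P) (degree Q) P Q)"
      by (simp add: line_poly_def p_def q_def F_def)
  qed
qed

section \<open>Local constancy of vanishing, and conclusion by connectedness\<close>

lemma vanishing_locally_constant:
  fixes S :: "(real^'m::finite) set" and P Q :: "'m mpoly poly"
  assumes pos: "0 < degree P" "0 < degree Q"
    and P0: "\<forall>x\<in>S. Eval x P \<noteq> 0"
    and res: "resultant_sub (degree P) (degree Q) P Q \<noteq> 0"
    and inv: "order_invariant (resultant_sub (degree P) (degree Q) P Q) S"
    and cont: "continuous_map (top_of_set S) RP1_top \<theta>"
    and m: "0 < m" "\<And>x. x \<in> S \<Longrightarrow> proj_root_mult (hform (degree P) (Eval x P)) (\<theta> x) m"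
    and x0: "x0 \<in> S"
  defines "Z \<equiv> \<lambda>x. \<forall>(u, v)\<in>\<theta> x. bf_eval (hform (degree Q) (Eval x Q)) u v = 0"
  shows "\<exists>\<eta>>0. \<forall>x\<in>S. dist x0 x < \<eta> \<longrightarrow> Z x = Z x0"
proof -
  define p q where "p = degree P" and "q = degree Q"
  obtain s \<zeta> \<delta>1 where \<delta>1: "0 < \<delta>1"
    and \<theta>: "\<And>x. x \<in> S \<Longrightarrow> dist x0 x < \<delta>1 \<Longrightarrow> \<theta> x = proj_class (chart_pt s (\<zeta> x))"
    and \<zeta>: "\<And>e. 0 < e \<Longrightarrow> \<exists>\<eta>>0. \<forall>x\<in>S. dist x0 x < \<eta> \<longrightarrow> \<bar>\<zeta> x0 - \<zeta> x\<bar> < e"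
    by (rule proj_chart_nbhd[OF cont x0]) (rule that)
  obtain w R \<delta>2 where R: "0 < R" "0 < \<delta>2"
    and Fnz: "\<And>x t. x \<in> S \<Longrightarrow> dist x0 x < \<delta>2 \<Longrightarrow> t \<noteq> 0 \<Longrightarrow> norm t < R \<Longrightarrow>
       ceval (\<lambda>i. of_real (vec_nth x i) + t * of_real (w i)) (resultant_sub p q P Q) \<noteq> 0"
  proof (rule order_invariant_direction[OF res inv x0])
    fix w R \<delta>
    assume "0 < R" "0 < \<delta>" "\<And>x t. x \<in> S \<Longrightarrow> dist x0 x < \<delta> \<Longrightarrow> t \<noteq> 0 \<Longrightarrow> norm t < R \<Longrightarrow>
       ceval (\<lambda>i. of_real (vec_nth x i) + t * of_real (w i)) (resultant_sub (degree P) (degree Q) P Q) \<noteq> 0"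
    then show thesis using that unfolding p_def q_def by blast
  qed
  obtain V where bez: "\<And>w y z. poly (line_poly s w p P y) z = 0 \<Longrightarrow>
    poly (line_poly s w (p - 1) V y) z * poly (line_poly s w q Q y) z =
      ceval (line_pt w y) (resultant_sub p q P Q)"
    using line_poly_bezout[OF pos, of s, folded p_def q_def] that by blast
  define \<delta> where "\<delta> = min \<delta>1 \<delta>2"
  define B where "B = line_poly s w q Q"
  have Bx: "poly (B (x, 0)) (of_real z) = of_real (poly (chart_poly s q (Eval x Q)) z)" for x z
    by (simp add: B_def line_poly_real poly_map_poly_of_real)
  have Z: "Z x \<longleftrightarrow> poly (B (x, 0)) (of_real (\<zeta> x)) = 0" if "x \<in> S" "dist x0 x < \<delta>1" for x
    unfolding Z_def Bx zero_on_class_iff(1)[OF \<theta>[OF that]] by (simp add: q_def)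
  have \<zeta>': "\<exists>\<eta>>0. \<forall>x\<in>S. dist x0 x < \<eta> \<longrightarrow> dist (complex_of_real (\<zeta> x0)) (of_real (\<zeta> x)) < e" if "0 < e" for e
    using \<zeta>[OF that] by (simp only: dist_of_real dist_real_def)
  have chart0: "chart_poly s p (Eval x P) \<noteq> 0" if "x \<in> S" for x
    using that P0 degree_Eval[of x P] by (simp add: chart_poly_eq_0_iff p_def)
  have "\<exists>\<eta>>0. \<forall>x\<in>S. dist x0 x < \<eta> \<longrightarrow> (poly (B (x, 0)) (of_real (\<zeta> x)) = 0) = (poly (B (x0, 0)) (of_real (\<zeta> x0)) = 0)"
  proof (cases "poly (B (x0, 0)) (of_real (\<zeta> x0)) = 0")
    case True
    have "\<exists>\<eta>>0. \<forall>x\<in>S. dist x0 x < \<eta> \<longrightarrow> poly (B (x, 0)) (of_real (\<zeta> x)) = 0"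
    \<comment> \<open>A single degree bound has to serve all three families, hence the
      maximum.\<close>
    proof (rule common_root_persists[where A = "line_poly s w p P" and B = B and V = "line_poly s w (p - 1) V"
          and F = "\<lambda>y. ceval (line_pt w y) (resultant_sub p q P Q)" and \<zeta> = "\<lambda>x. of_real (\<zeta> x)"
          and d = "max p q" and \<delta> = \<delta> and R = R and m = m])
      \<comment> \<open>The multiplicity of the projective root is the order of the chart
        polynomial, and passing to complex coefficients preserves it.\<close>
      show "order (complex_of_real (\<zeta> x)) (line_poly s w p P (x, 0)) = m" if x: "x \<in> S" "dist x0 x < \<delta>" for x
      proof -
        from m(2)[OF x(1)] obtain u v where uv: "(u, v) \<noteq> (0, 0)" "\<theta> x = proj_class (u, v)"
          "bf_mult (hform p (Eval x P)) u v = m"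
          unfolding proj_root_mult_def p_def by blast
        have "proj_class (chart_pt s (\<zeta> x)) = proj_class (u, v)"
          using \<theta>[OF x(1)] x(2) uv(2) by (simp add: \<delta>_def)
        from bf_mult_eq_order[OF chart0[OF x(1)] uv(1) this] uv(3) show ?thesis
          by (simp add: line_poly_real order_map_poly_of_real)
      qed
      show "line_poly s w p P (x, 0) \<noteq> 0" if "x \<in> S" for x
        using chart0[OF that] by (simp add: line_poly_real)
      show "ceval (line_pt w (x, t)) (resultant_sub p q P Q) \<noteq> 0"
        if "x \<in> S" "dist x0 x < \<delta>" "t \<noteq> 0" "norm t < R" for x t
        using Fnz[of x t] that by (simp add: line_pt_def \<delta>_def)
    qed (use bez x0 R \<delta>1 m(1) \<zeta>' True in \<open>auto simp: B_def \<delta>_def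
          intro!: poly_family_line_poly hol_param_coeff_line_poly hol_param_ceval_line_pt\<close>)
    with True show ?thesis by simp
  next
    case False
    have "poly_family q B" unfolding B_def by (rule poly_family_line_poly) simp
    from continuous_on_poly_family[OF this] have contB: "continuous_on UNIV (\<lambda>(y, z). poly (B y) z)" .
    have "continuous_on UNIV (\<lambda>k. (\<lambda>(y, z). poly (B y) z) ((fst k, 0), snd k))"
      by (intro continuous_on_compose2[OF contB] continuous_intros) auto
    then have "isCont (\<lambda>k. (\<lambda>(y, z). poly (B y) z) ((fst k, 0), snd k)) (x0, of_real (\<zeta> x0))"
      using continuous_on_eq_continuous_at[OF open_UNIV] by blast
    from continuous_at_avoid[OF this, of 0] False
    obtain e where e: "e > 0" "\<And>x z. dist (x0, of_real (\<zeta> x0)) (x, z) < e \<Longrightarrow> poly (B (x, 0)) z \<noteq> 0"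
      by auto
    from \<zeta>'[of "e / 2"] e(1) obtain \<eta> where \<eta>: "\<eta> > 0"
      "\<forall>x\<in>S. dist x0 x < \<eta> \<longrightarrow> dist (complex_of_real (\<zeta> x0)) (of_real (\<zeta> x)) < e / 2" by auto
    have "poly (B (x, 0)) (of_real (\<zeta> x)) \<noteq> 0" if "x \<in> S" "dist x0 x < min \<eta> (e / 2)" for x
    proof (rule e(2))
      have "dist (x0, complex_of_real (\<zeta> x0)) (x, of_real (\<zeta> x)) \<le> dist x0 x + dist (complex_of_real (\<zeta> x0)) (of_real (\<zeta> x))"
        by (simp add: dist_Pair_Pair sqrt_sum_squares_le_sum)
      also have "\<dots> < e / 2 + e / 2" using \<eta>(2) that by (intro add_strict_mono) auto
      finally show "dist (x0, complex_of_real (\<zeta> x0)) (x, of_real (\<zeta> x)) < e" by simp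
    qed
    with False \<eta>(1) e(1) show ?thesis by (intro exI[of _ "min \<eta> (e / 2)"]) auto
  qed
  then obtain \<eta> where \<eta>: "\<eta> > 0" "\<forall>x\<in>S. dist x0 x < \<eta> \<longrightarrow>
      (poly (B (x, 0)) (of_real (\<zeta> x)) = 0) = (poly (B (x0, 0)) (of_real (\<zeta> x0)) = 0)"
    by (elim exE conjE)
  have "Z x = Z x0" if "x \<in> S" "dist x0 x < min \<eta> \<delta>1" for x
    using Z[of x] Z[of x0] \<eta>(2) that x0 \<delta>1 by simp
  with \<eta>(1) \<delta>1 show ?thesis by (intro exI[of _ "min \<eta> \<delta>1"]) auto
qed

theorem mainTheorem11:
  fixes S :: "(real^'m::finite) set"
    and P Q :: "'m mpoly poly"
    and k :: nat and \<theta> :: "nat \<Rightarrow> real^'m \<Rightarrow> (real \<times> real) set" and l :: nat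
  assumes "connected S" and "analytic_submanifold S"
    and "degree P > 0" and "degree Q > 0"
    and "\<forall>x\<in>S. Eval x P \<noteq> 0" and "\<forall>x\<in>S. Eval x Q \<noteq> 0"
    and "proj_delineable S P"
    and "proj_delineable_with S P k \<theta>" and "l < k"
    and "resultant_sub (degree P) (degree Q) P Q \<noteq> 0"
    and "order_invariant (resultant_sub (degree P) (degree Q) P Q) S"
  shows "(\<forall>x\<in>S. \<forall>(u, v)\<in>\<theta> l x. bf_eval (hform (degree Q) (Eval x Q)) u v = 0) \<or>
         (\<forall>x\<in>S. \<forall>(u, v)\<in>\<theta> l x. bf_eval (hform (degree Q) (Eval x Q)) u v \<noteq> 0)"
proof -
  have cont: "continuous_map (top_of_set S) RP1_top (\<theta> l)"
    using assms(8,9) unfolding proj_delineable_with_def by blast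
  obtain m where m: "1 \<le> m" "\<forall>x\<in>S. proj_root_mult (hform (degree P) (Eval x P)) (\<theta> l x) m"
    using assms(8,9) unfolding proj_delineable_with_def by blast
  define Z where "Z = (\<lambda>x. \<forall>(u, v)\<in>\<theta> l x. bf_eval (hform (degree Q) (Eval x Q)) u v = 0)"
  have loc: "\<exists>\<eta>>0. \<forall>x\<in>S. dist a x < \<eta> \<longrightarrow> Z x = Z a" if "a \<in> S" for a
    unfolding Z_def using m
    by (intro vanishing_locally_constant[OF assms(3,4,5,10,11) cont _ _ that, of m]) auto
  have const: "Z a = Z b" if "a \<in> S" "b \<in> S" for a b
  proof (rule connected_local_const[OF assms(1) that])
    show "\<forall>a\<in>S. eventually (\<lambda>b. Z a = Z b) (at a within S)"
    proof
      fix a assume "a \<in> S"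
      from loc[OF this] obtain \<eta> where "\<eta> > 0" "\<forall>x\<in>S. dist a x < \<eta> \<longrightarrow> Z x = Z a" by (elim exE conjE)
      then show "eventually (\<lambda>b. Z a = Z b) (at a within S)"
        unfolding eventually_at by (intro exI[of _ \<eta>]) (simp add: dist_commute)
    qed
  qed
  \<comment> \<open>The negation of \<open>Z x\<close> yields just one representative where
    \<open>Q\<close> is nonzero; homogeneity extends this to all of them.\<close>
  have nonzero: "\<forall>(u, v)\<in>\<theta> l x. bf_eval (hform (degree Q) (Eval x Q)) u v \<noteq> 0" if "x \<in> S" "\<not> Z x" for x
  proof (rule proj_chart_nbhd[OF cont that(1)])
    fix s \<zeta> \<delta>
    assume "0 < \<delta>" and c: "\<And>y. y \<in> S \<Longrightarrow> dist x y < \<delta> \<Longrightarrow> \<theta> l y = proj_class (chart_pt s (\<zeta> y))"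
    then have "\<theta> l x = proj_class (chart_pt s (\<zeta> x))" using that(1) by simp
    from zero_on_class_iff[OF this, of "degree Q" "Eval x Q"] that(2) show ?thesis
      unfolding Z_def by simp
  qed
  show ?thesis
  proof (cases "\<exists>x\<in>S. Z x")
    case True
    with const have "\<forall>x\<in>S. Z x" by blast
    then show ?thesis unfolding Z_def by (rule disjI1)
  next
    case False
    with nonzero have "\<forall>x\<in>S. \<forall>(u, v)\<in>\<theta> l x. bf_eval (hform (degree Q) (Eval x Q)) u v \<noteq> 0" by blast
    then show ?thesis by (rule disjI2)
  qed
qed

end
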